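(* Let $(\mathcal{A},\tau)$ be a unital $C^*$-algebra with a faithful tracial state $\tau$, and let $\mathcal{A}_{++}$ be the set of invertible positive elements of $\mathcal{A}$. For $A,B\in\mathcal{A}_{++}$ define $$d_\tau^2(A,B):=\tau\!\left(\log\!\left(\frac{A+B}{2}\right)\right)-\frac12\tau(\log A)-\frac12\tau(\log B).$$ Then $d_\tau:=\sqrt{d_\tau^2}$ is a metric on $\mathcal{A}_{++}$ (in particular $d_\tau^2\ge 0$). In particular, its restriction to $\mathcal{S}_{\tau,++}:=\{\rho\in\mathcal{A}_{++}:\tau(\rho)=1\}$ is a metric.
   Context: A faithful tracial state on a unital $C^*$-algebra $\mathcal{A}$ is a positive linear functional $\tau:\mathcal{A}\to\mathbb{C}$ with $\tau(\mathbf{1})=1$, $\tau(xy)=\tau(yx)$ for all $x,y\in\mathcal{A}$, and $\tau(x^*x)=0\Rightarrow x=0$. $\log$ is applied by continuous functional calculus. *)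

theory Defs
  imports "HOL-Analysis.Analysis"
begin

text \<open>Unital complex C*-algebras. The superclass \<open>real_normed_algebra_1\<close> contributes
  \<open>norm 1 = 1\<close>, which in a C*-algebra only excludes the zero algebra; that algebra
  carries no state.\<close>

class cstar_algebra = real_normed_algebra_1 + banach +
  fixes scaleC :: "complex \<Rightarrow> 'a \<Rightarrow> 'a"  (infixr "*\<^sub>C" 75)
    and star :: "'a \<Rightarrow> 'a"
  assumes scaleR_scaleC: "r *\<^sub>R a = complex_of_real r *\<^sub>C a"
    and scaleC_add_right: "z *\<^sub>C (a + b) = z *\<^sub>C a + z *\<^sub>C b"
    and scaleC_add_left: "(z + w) *\<^sub>C a = z *\<^sub>C a + w *\<^sub>C a"
    and scaleC_scaleC: "z *\<^sub>C w *\<^sub>C a = (z * w) *\<^sub>C a"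
    and scaleC_one: "1 *\<^sub>C a = a"
    and mult_scaleC_left: "(z *\<^sub>C a) * b = z *\<^sub>C (a * b)"
    and mult_scaleC_right: "a * (z *\<^sub>C b) = z *\<^sub>C (a * b)"
    and norm_scaleC: "norm (z *\<^sub>C a) = cmod z * norm a"
    and star_star: "star (star a) = a"
    and star_add: "star (a + b) = star a + star b"
    and star_scaleC: "star (z *\<^sub>C a) = cnj z *\<^sub>C star a"
    and star_mult: "star (a * b) = star b * star a"
    and cstar_identity: "norm (star a * a) = (norm a)\<^sup>2"

definition invertible_elem :: "'a::monoid_mult \<Rightarrow> bool" where
  "invertible_elem a \<longleftrightarrow> (\<exists>b. a * b = 1 \<and> b * a = 1)"

definition spectrum :: "'a::cstar_algebra \<Rightarrow> complex set" where
  "spectrum a = {z. \<not> invertible_elem (z *\<^sub>C 1 - a)}"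

definition positive_elem :: "'a::cstar_algebra \<Rightarrow> bool" where
  "positive_elem a \<longleftrightarrow> star a = a \<and> spectrum a \<subseteq> \<real>\<^sub>\<ge>\<^sub>0"

definition pos_invertibles :: "'a::cstar_algebra set" where
  "pos_invertibles = {a. positive_elem a \<and> invertible_elem a}"

text \<open>\<open>\<Phi>\<close> represents the isometric unital *-homomorphism from the continuous functions on the
  spectrum of \<open>a\<close> into the algebra that sends the identity function to \<open>a\<close>. Elements of
  \<open>C(spectrum a)\<close> are represented by total functions that are continuous on the spectrum;
  \<open>isometric\<close> forces \<open>\<Phi> f\<close> to depend only on the values of \<open>f\<close> there. By
  Stone--Weierstrass, the values of \<open>\<Phi>\<close> on such functions are unique, and \<open>\<Phi>\<close> exists exactly
  when \<open>a\<close> is normal.\<close>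

locale continuous_functional_calculus =
  fixes a :: "'a::cstar_algebra" and \<Phi> :: "(complex \<Rightarrow> complex) \<Rightarrow> 'a"
  assumes add: "\<lbrakk>continuous_on (spectrum a) f; continuous_on (spectrum a) g\<rbrakk>
      \<Longrightarrow> \<Phi> (\<lambda>z. f z + g z) = \<Phi> f + \<Phi> g"
    and scaleC: "continuous_on (spectrum a) f \<Longrightarrow> \<Phi> (\<lambda>z. c * f z) = c *\<^sub>C \<Phi> f"
    and mult: "\<lbrakk>continuous_on (spectrum a) f; continuous_on (spectrum a) g\<rbrakk>
      \<Longrightarrow> \<Phi> (\<lambda>z. f z * g z) = \<Phi> f * \<Phi> g"
    and star: "continuous_on (spectrum a) f \<Longrightarrow> \<Phi> (\<lambda>z. cnj (f z)) = star (\<Phi> f)"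
    and one: "\<Phi> (\<lambda>z. 1) = 1"
    and ident: "\<Phi> (\<lambda>z. z) = a"
    and isometric: "continuous_on (spectrum a) f
      \<Longrightarrow> norm (\<Phi> f) = (SUP z\<in>spectrum a. cmod (f z))"

definition cfc :: "(complex \<Rightarrow> complex) \<Rightarrow> 'a::cstar_algebra \<Rightarrow> 'a" where
  "cfc f a = (SOME \<Phi>. continuous_functional_calculus a \<Phi>) f"

text \<open>On the positive reals the principal branch \<open>Ln\<close> is the real logarithm.\<close>

definition log_elem :: "'a::cstar_algebra \<Rightarrow> 'a" where
  "log_elem a = cfc Ln a"

locale faithful_tracial_state =
  fixes \<tau> :: "'a::cstar_algebra \<Rightarrow> complex"
  assumes add: "\<tau> (x + y) = \<tau> x + \<tau> y"
    and scaleC: "\<tau> (z *\<^sub>C x) = z * \<tau> x"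
    and positive: "\<tau> (star x * x) \<in> \<real>\<^sub>\<ge>\<^sub>0"
    and unital: "\<tau> 1 = 1"
    and tracial: "\<tau> (x * y) = \<tau> (y * x)"
    and faithful: "\<tau> (star x * x) = 0 \<Longrightarrow> x = 0"

definition d_tau_sq :: "('a::cstar_algebra \<Rightarrow> complex) \<Rightarrow> 'a \<Rightarrow> 'a \<Rightarrow> complex" where
  "d_tau_sq \<tau> A B =
    \<tau> (log_elem ((1 / 2) *\<^sub>C (A + B))) - 1 / 2 * \<tau> (log_elem A) - 1 / 2 * \<tau> (log_elem B)"

definition d_tau :: "('a::cstar_algebra \<Rightarrow> complex) \<Rightarrow> 'a \<Rightarrow> 'a \<Rightarrow> real" where
  "d_tau \<tau> A B = sqrt (Re (d_tau_sq \<tau> A B))"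

definition pos_densities :: "('a::cstar_algebra \<Rightarrow> complex) \<Rightarrow> 'a set" where
  "pos_densities \<tau> = {\<rho> \<in> pos_invertibles. \<tau> \<rho> = 1}"

text \<open>The locale \<open>Metric_space M d\<close> asks for nonnegativity and symmetry of \<open>d\<close> on the whole type,
  so a function that is only meaningful on \<open>M \<times> M\<close> is extended by zero.\<close>

definition restrict_dist :: "'a set \<Rightarrow> ('a \<Rightarrow> 'a \<Rightarrow> real) \<Rightarrow> 'a \<Rightarrow> 'a \<Rightarrow> real" where
  "restrict_dist M d = (\<lambda>x y. if x \<in> M \<and> y \<in> M then d x y else 0)"

end

theory Submission
  imports Defs "HOL-Computational_Algebra.Fundamental_Theorem_Algebra"
begin

text \<open>Write \<open>L\<close> for the trace of the logarithm. Two facts carry the proof. First, \<open>L\<close> is a Fuglede--Kadison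
  determinant: \<open>L (x y x) = L y + 2 L x\<close>, so the divergence is invariant under congruence and one of the
  three points of the triangle may be taken to be \<open>1\<close>. Second, if \<open>f u + g v \<le> ln ((u + v) / 2)\<close> for all scalars in
  the spectra of \<open>a\<close> and \<open>b\<close>, then \<open>tr (f a) + tr (g b) \<le> L ((a + b) / 2)\<close>, although \<open>a\<close> and \<open>b\<close> need not
  commute; for matrices this is Jensen's inequality in an eigenbasis of \<open>a + b\<close>, and here Bernstein
  polynomials of \<open>a + b\<close> play the role of the eigenprojections. The scalar triangle inequality, in the
  form \<open>(s + t)\<^sup>2 \<le> s\<^sup>2 / l + t\<^sup>2 / (1 - l)\<close> in which the two spectral variables separate, then passes to the
  algebra; it holds because \<open>ln (cosh s) / s\<^sup>2\<close> is decreasing.\<close>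

section \<open>Invertibility and the spectrum\<close>

text \<open>The triangle inequality concerns square roots of traces, while the trace respects only
  linear inequalities. For a fixed weight \<open>l\<close> the weighted form is linear in the
  squared distances, so it can be traced; choosing \<open>l\<close> afterwards restores the square
  roots. Normalising one point to \<open>1\<close> is what makes tracing possible: two of the three
  squared distances become traces of functions of a single element, and the third couples the two
  spectra only through \<open>ln ((u + v) / 2)\<close>, which is the shape that the second fact
  accepts. A C*-algebra need not contain the spectral projections of its elements, so no step may
  cut along a spectrum. Operator inequalities between elements that do not commute are avoided as
  well: everything is compared under the trace, where a product of two positive elements has a
  nonnegative value. As \<open>cfc\<close> is chosen by \<open>SOME\<close>, its existence for
  self-adjoint elements has to be established before anything can be said of
  \<open>log_elem\<close>; this rests on a spectral point of modulus \<open>norm a\<close>.\<close>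

lemma scaleC_zero_left [simp]: "0 *\<^sub>C (a::'a::cstar_algebra) = 0"
  using scaleR_scaleC[of 0 a] by simp

lemma scaleC_zero_right [simp]: "z *\<^sub>C (0::'a::cstar_algebra) = 0"
  using mult_scaleC_right[of 0 z 0] by (metis mult_zero_left)

lemma scaleC_minus_left [simp]: "(- z) *\<^sub>C (a::'a::cstar_algebra) = - (z *\<^sub>C a)"
  using scaleC_add_left[of z "- z" a] by (simp add: eq_neg_iff_add_eq_0 add.commute)

lemma scaleC_minus_right [simp]: "z *\<^sub>C (- a::'a::cstar_algebra) = - (z *\<^sub>C a)"
  using scaleC_add_right[of z a "- a"] by (simp add: eq_neg_iff_add_eq_0 add.commute)

lemma scaleC_diff_left: "(z - w) *\<^sub>C (a::'a::cstar_algebra) = z *\<^sub>C a - w *\<^sub>C a"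
  using scaleC_add_left[of z "- w" a] by simp

lemma scaleC_diff_right: "z *\<^sub>C (a - b::'a::cstar_algebra) = z *\<^sub>C a - z *\<^sub>C b"
  using scaleC_add_right[of z a "- b"] by simp

lemma scaleC_of_real: "complex_of_real r *\<^sub>C (a::'a::cstar_algebra) = r *\<^sub>R a"
  by (simp add: scaleR_scaleC)

lemma star_zero [simp]: "star (0::'a::cstar_algebra) = 0"
  using star_add[of "0::'a" 0] by simp

lemma star_minus [simp]: "star (- a::'a::cstar_algebra) = - star a"
  using star_add[of a "- a"] by (simp add: eq_neg_iff_add_eq_0 add.commute)

lemma star_diff: "star (a - b::'a::cstar_algebra) = star a - star b"
  using star_add[of a "- b"] by simp

lemma star_one [simp]: "star (1::'a::cstar_algebra) = 1"
  by (metis star_mult star_star mult.left_neutral mult.right_neutral)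

lemma star_scaleR: "star (r *\<^sub>R a::'a::cstar_algebra) = r *\<^sub>R star a"
  by (simp add: scaleR_scaleC star_scaleC)

lemma star_power: "star (a ^ n::'a::cstar_algebra) = star a ^ n"
  by (induction n) (simp_all add: star_mult power_commutes)

lemma norm_star [simp]: "norm (star a) = norm (a::'a::cstar_algebra)"
proof -
  have le: "norm b \<le> norm (star b)" for b :: 'a
  proof (cases "b = 0")
    case False
    have "norm b * norm b \<le> norm (star b) * norm b"
      using cstar_identity[of b] norm_mult_ineq[of "star b" b] by (simp add: power2_eq_square)
    then show ?thesis using False by simp
  qed simp
  show ?thesis using le[of a] le[of "star a"] by (simp add: star_star)
qed

lemma bounded_linear_star: "bounded_linear (star :: 'a::cstar_algebra \<Rightarrow> 'a)"
  by (rule bounded_linear_intro[where K = 1]) (simp_all add: star_add star_scaleR)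

lemma bounded_linear_scaleC: "bounded_linear ((*\<^sub>C) z :: 'a::cstar_algebra \<Rightarrow> 'a)"
  by (rule bounded_linear_intro[where K = "cmod z"])
    (simp_all add: scaleC_add_right scaleR_scaleC scaleC_scaleC norm_scaleC mult.commute)

definition is_inverse :: "'a::monoid_mult \<Rightarrow> 'a \<Rightarrow> bool" where
  "is_inverse a b \<longleftrightarrow> a * b = 1 \<and> b * a = 1"

lemma invertible_elem_iff: "invertible_elem a \<longleftrightarrow> (\<exists>b. is_inverse a b)"
  by (simp add: invertible_elem_def is_inverse_def)

lemma is_inverse_unique: "is_inverse a b \<Longrightarrow> is_inverse a c \<Longrightarrow> b = c"
  unfolding is_inverse_def by (metis mult.assoc mult.left_neutral mult.right_neutral)

lemma is_inverse_mult: "is_inverse a b \<Longrightarrow> is_inverse c d \<Longrightarrow> is_inverse (a * c) (d * b)"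
  unfolding is_inverse_def by (metis mult.assoc mult.left_neutral)

lemma invertible_elem_mult: "invertible_elem a \<Longrightarrow> invertible_elem b \<Longrightarrow> invertible_elem (a * b)"
  unfolding invertible_elem_iff by (meson is_inverse_mult)

text \<open>A commuting product with inverse \<open>c\<close> gives \<open>a\<close> the right
  inverse \<open>b * c\<close> and the left inverse \<open>c * b\<close>, and these coincide.
  Spectral mapping uses it to pass from a polynomial to one of its linear factors.\<close>

lemma invertible_elem_of_commuting_product:
  assumes "invertible_elem (a * b)" "a * b = b * a"
  shows "invertible_elem a"
proof -
  obtain c where c: "a * b * c = 1" "c * (a * b) = 1"
    using assms(1) by (auto simp: invertible_elem_def)
  have 1: "a * (b * c) = 1" using c by (simp add: mult.assoc)
  have 2: "(c * b) * a = 1" using c assms(2) by (simp add: mult.assoc)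
  have "c * b = b * c" using 1 2 by (metis mult.assoc mult.left_neutral mult.right_neutral)
  then show ?thesis using 1 2 by (auto simp: invertible_elem_def)
qed

text \<open>The resolvent identity, which turns closeness of elements into closeness of their
  inverses.\<close>

lemma is_inverse_diff:
  fixes a :: "'a::ring_1"
  assumes "is_inverse a b" "is_inverse c d"
  shows "b - d = b * (c - a) * d"
  using assms unfolding is_inverse_def by (simp add: algebra_simps flip: mult.assoc) (simp add: mult.assoc)

lemma invertible_one_minus:
  fixes x :: "'a::{real_normed_algebra_1,banach}"
  assumes "norm x < 1"
  shows "invertible_elem (1 - x)"
proof -
  have "summable (\<lambda>n. norm x ^ n)" using assms by (simp add: summable_geometric)
  then have s: "summable (\<lambda>n. x ^ n)"
    by (rule summable_comparison_test'[where N = 0]) (simp add: norm_power_ineq)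
  define S where "S = (\<Sum>n. x ^ n)"
  have split: "S = 1 + (\<Sum>n. x ^ Suc n)"
    unfolding S_def using suminf_split_head[OF s] by simp
  have "x * S = (\<Sum>n. x ^ Suc n)" "S * x = (\<Sum>n. x ^ Suc n)"
    unfolding S_def using suminf_mult[OF s, of x] suminf_mult2[OF s, of x]
    by (simp_all add: power_commutes[symmetric])
  then have "(1 - x) * S = 1" "S * (1 - x) = 1"
    using split by (simp_all add: algebra_simps)
  then show ?thesis by (auto simp: invertible_elem_def)
qed

text \<open>The second factor of \<open>c = a * (1 - b * (a - c))\<close> is invertible by the
  Neumann series. Openness of the units makes the spectrum closed.\<close>

lemma invertible_elem_near:
  fixes a :: "'a::{real_normed_algebra_1,banach}"
  assumes ab: "is_inverse a b" and "norm (c - a) * norm b < 1"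
  shows "invertible_elem c"
proof -
  have "norm (b * (a - c)) < 1"
    using assms(2) norm_mult_ineq[of b "a - c"] by (simp add: norm_minus_commute mult.commute)
  then have "invertible_elem (1 - b * (a - c))" by (rule invertible_one_minus)
  moreover have "c = a * (1 - b * (a - c))"
    using ab unfolding is_inverse_def by (simp add: algebra_simps flip: mult.assoc)
  moreover have "invertible_elem a" using ab by (auto simp: invertible_elem_iff)
  ultimately show ?thesis by (metis invertible_elem_mult)
qed

lemma invertible_elem_scaleC_iff:
  assumes "z \<noteq> 0"
  shows "invertible_elem (z *\<^sub>C (a::'a::cstar_algebra)) \<longleftrightarrow> invertible_elem a"
proof -
  have imp: "invertible_elem (w *\<^sub>C b)" if w: "w \<noteq> 0" and b: "invertible_elem b" for w and b :: 'a
  proof -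
    obtain c where "is_inverse b c" using b by (auto simp: invertible_elem_iff)
    then have "is_inverse (w *\<^sub>C b) (inverse w *\<^sub>C c)"
      using w by (simp add: is_inverse_def mult_scaleC_left mult_scaleC_right scaleC_scaleC scaleC_one)
    then show ?thesis by (auto simp: invertible_elem_iff)
  qed
  show ?thesis
    using imp[OF assms, of a] imp[of "inverse z" "z *\<^sub>C a"] assms
    by (auto simp: scaleC_scaleC scaleC_one)
qed

lemma spectrum_bound:
  assumes "z \<in> spectrum (a::'a::cstar_algebra)"
  shows "cmod z \<le> norm a"
proof (rule ccontr)
  assume "\<not> ?thesis"
  then have z0: "z \<noteq> 0" "norm a < cmod z" by auto
  then have z: "z \<noteq> 0" "norm (inverse z *\<^sub>C a) < 1"
    by (simp_all add: norm_scaleC norm_inverse norm_divide divide_simps)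
  have "z *\<^sub>C 1 - a = z *\<^sub>C (1 - inverse z *\<^sub>C a)"
    using z(1) by (simp add: scaleC_diff_right scaleC_scaleC scaleC_one)
  then show False
    using assms invertible_one_minus[OF z(2)] invertible_elem_scaleC_iff[OF z(1)]
    by (auto simp: spectrum_def)
qed

lemma closed_spectrum: "closed (spectrum (a::'a::cstar_algebra))"
proof -
  have "open (- spectrum a)"
    unfolding open_dist
  proof
    fix z assume "z \<in> - spectrum a"
    then obtain b where b: "is_inverse (z *\<^sub>C 1 - a) b"
      by (auto simp: spectrum_def invertible_elem_iff)
    have "b \<noteq> 0" using b by (auto simp: is_inverse_def)
    show "\<exists>e>0. \<forall>w. dist w z < e \<longrightarrow> w \<in> - spectrum a"
    proof (intro exI conjI allI impI)
      show "inverse (norm b) > 0" using \<open>b \<noteq> 0\<close> by simp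
      fix w assume "dist w z < inverse (norm b)"
      then have "norm ((w *\<^sub>C 1 - a) - (z *\<^sub>C 1 - a)) * norm b < 1"
        using \<open>b \<noteq> 0\<close> by (simp add: scaleC_diff_left[symmetric] norm_scaleC dist_norm field_simps)
      then show "w \<in> - spectrum a"
        using invertible_elem_near[OF b] by (simp add: spectrum_def)
    qed
  qed
  then show ?thesis by (simp add: closed_def)
qed

lemma compact_spectrum: "compact (spectrum (a::'a::cstar_algebra))"
  unfolding compact_eq_bounded_closed
  using closed_spectrum spectrum_bound by (auto simp: bounded_iff)

section \<open>Norm and spectrum of self-adjoint elements\<close>

lemma norm_power_selfadjoint:
  assumes "star a = (a::'a::cstar_algebra)"
  shows "norm (a ^ 2 ^ k) = norm a ^ 2 ^ k"
proof (induction k)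
  case (Suc k)
  have "norm (a ^ 2 ^ Suc k) = norm (star (a ^ 2 ^ k) * a ^ 2 ^ k)"
    by (simp add: star_power assms mult_2 power_add)
  also have "\<dots> = (norm a ^ 2 ^ k)\<^sup>2" using Suc by (simp add: cstar_identity)
  finally show ?case by (simp add: power_mult[symmetric] mult.commute)
qed simp

text \<open>Rickart's argument without complex analysis. If \<open>1 - z a\<close> were invertible on the closed unit
  disc, uniform continuity of the resolvents would pass unchanged to \<open>1 - z a\<^bsup>2^k\<^esup>\<close>, because
  \<open>(1 - z\<^sup>2 b\<^sup>2)\<inverse>\<close> is the mean of \<open>(1 - z b)\<inverse>\<close> and \<open>(1 + z b)\<inverse>\<close>.\<close>

lemma noninvertible_on_unit_disc:
  fixes a :: "'a::cstar_algebra"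
  assumes sa: "star a = a" and n1: "norm a = 1"
  shows "\<exists>z. cmod z \<le> 1 \<and> \<not> invertible_elem (1 - z *\<^sub>C a)"
proof (rule ccontr)
  assume "\<not> ?thesis"
  then have inv: "invertible_elem (1 - z *\<^sub>C a)" if "cmod z \<le> 1" for z using that by blast
  \<comment> \<open>The inverse is a default value of \<open>SOME\<close> until \<open>Finv\<close>
    proves that it exists on the closed disc. Every point of the disc has its square roots there, so
    the induction in \<open>Finv\<close> never leaves the disc.\<close>
  define F where "F k z = (SOME y. is_inverse (1 - z *\<^sub>C a ^ 2 ^ k) y)" for k :: nat and z
  have half: "is_inverse (1 - z\<^sup>2 *\<^sub>C (b * b)) ((1/2) *\<^sub>R (y + y'))"
    if "is_inverse (1 - z *\<^sub>C b) y" "is_inverse (1 - (- z) *\<^sub>C b) y'" for z y y' and b :: 'a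
  proof -
    have sq: "z\<^sup>2 *\<^sub>C (b * b) = (z *\<^sub>C b) * (z *\<^sub>C b)"
      by (simp add: mult_scaleC_left mult_scaleC_right scaleC_scaleC power2_eq_square)
    have e: "1 - z\<^sup>2 *\<^sub>C (b * b) = (1 + z *\<^sub>C b) * (1 - z *\<^sub>C b)"
      "1 - z\<^sup>2 *\<^sub>C (b * b) = (1 - z *\<^sub>C b) * (1 + z *\<^sub>C b)"
      unfolding sq by (simp_all add: ring_distribs)
    have r: "(1 - z *\<^sub>C b) * y = 1" "(1 + z *\<^sub>C b) * y' = 1" "y * (1 - z *\<^sub>C b) = 1" "y' * (1 + z *\<^sub>C b) = 1"
      using that by (auto simp: is_inverse_def)
    have "(1 - z\<^sup>2 *\<^sub>C (b * b)) * y = 1 + z *\<^sub>C b" "(1 - z\<^sup>2 *\<^sub>C (b * b)) * y' = 1 - z *\<^sub>C b"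
      by (metis e(1) r(1) mult.assoc mult.right_neutral, metis e(2) r(2) mult.assoc mult.right_neutral)
    moreover have "y * (1 - z\<^sup>2 *\<^sub>C (b * b)) = 1 + z *\<^sub>C b" "y' * (1 - z\<^sup>2 *\<^sub>C (b * b)) = 1 - z *\<^sub>C b"
      by (metis e(2) r(3) mult.assoc mult.left_neutral, metis e(1) r(4) mult.assoc mult.left_neutral)
    moreover have "(1/2) *\<^sub>R ((1 + z *\<^sub>C b) + (1 - z *\<^sub>C b)) = 1"
      by (simp flip: scaleR_2)
    ultimately show ?thesis
      unfolding is_inverse_def by (simp only: mult_scaleR_right mult_scaleR_left distrib_left distrib_right)
  qed
  have sq: "a ^ 2 ^ Suc k = a ^ 2 ^ k * a ^ 2 ^ k" for k by (simp add: mult_2 power_add)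
  have Finv: "is_inverse (1 - z *\<^sub>C a ^ 2 ^ k) (F k z)" if "cmod z \<le> 1" for k z
    using that
  proof (induction k arbitrary: z)
    case 0
    then show ?case unfolding F_def using inv by (metis invertible_elem_iff someI_ex power_0 power_one_right)
  next
    case (Suc k)
    have "cmod (csqrt z) \<le> 1" using Suc.prems by simp
    then have "is_inverse (1 - (csqrt z)\<^sup>2 *\<^sub>C (a ^ 2 ^ k * a ^ 2 ^ k)) ((1/2) *\<^sub>R (F k (csqrt z) + F k (- csqrt z)))"
      by (intro half Suc.IH) simp_all
    then show ?case unfolding F_def sq by (metis power2_csqrt someI_ex)
  qed
  have Fsq: "F (Suc k) (z\<^sup>2) = (1/2) *\<^sub>R (F k z + F k (- z))" if "cmod z \<le> 1" for k z
  proof -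
    have "is_inverse (1 - z\<^sup>2 *\<^sub>C (a ^ 2 ^ k * a ^ 2 ^ k)) ((1/2) *\<^sub>R (F k z + F k (- z)))"
      using that by (intro half Finv) simp_all
    moreover have "is_inverse (1 - z\<^sup>2 *\<^sub>C (a ^ 2 ^ Suc k)) (F (Suc k) (z\<^sup>2))"
      using that by (intro Finv) (simp add: norm_power power_le_one)
    ultimately show ?thesis unfolding sq by (intro is_inverse_unique)
  qed
  have cont: "continuous_on (cball 0 1) (F 0)"
    unfolding continuous_on_iff
  proof (intro ballI allI impI)
    fix w :: complex and e :: real assume w: "w \<in> cball 0 1" and e: "e > 0"
    define C where "C = norm (F 0 w) + 1"
    have C: "C > 0" "norm (F 0 w) \<le> C" by (simp_all add: C_def add_nonneg_pos)
    show "\<exists>d>0. \<forall>z\<in>cball 0 1. dist z w < d \<longrightarrow> dist (F 0 z) (F 0 w) < e"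
    proof (intro exI conjI ballI impI)
      \<comment> \<open>The resolvent identity bounds the difference by a multiple of
        \<open>norm (F 0 z)\<close>, which is not yet controlled. The first bound lets half of
        \<open>norm (F 0 z)\<close> be absorbed, so that it is at most \<open>2 * C\<close>; the
        second then yields \<open>e\<close>.\<close>
      show "min (1 / (2 * C)) (e / (2 * C\<^sup>2)) > 0" using C e by simp
      fix z :: complex assume z: "z \<in> cball 0 1" and d: "dist z w < min (1 / (2 * C)) (e / (2 * C\<^sup>2))"
      have "F 0 z - F 0 w = F 0 z * ((1 - w *\<^sub>C a) - (1 - z *\<^sub>C a)) * F 0 w"
        using Finv[of z 0] Finv[of w 0] z w by (intro is_inverse_diff) auto
      also have "(1 - w *\<^sub>C a) - (1 - z *\<^sub>C a) = (z - w) *\<^sub>C a" by (simp add: scaleC_diff_left)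
      finally have "norm (F 0 z - F 0 w) = norm (F 0 z * ((z - w) *\<^sub>C a) * F 0 w)" by simp
      also have "\<dots> \<le> norm (F 0 z * ((z - w) *\<^sub>C a)) * norm (F 0 w)" by (rule norm_mult_ineq)
      also have "\<dots> \<le> norm (F 0 z) * norm ((z - w) *\<^sub>C a) * norm (F 0 w)"
        by (intro mult_right_mono norm_mult_ineq norm_ge_zero)
      also have "\<dots> = norm (F 0 z) * dist z w * norm (F 0 w)" by (simp add: norm_scaleC n1 dist_norm)
      also have "\<dots> \<le> norm (F 0 z) * dist z w * C"
        using C by (intro mult_left_mono) auto
      finally have 1: "norm (F 0 z - F 0 w) \<le> norm (F 0 z) * (dist z w * C)" by (simp add: mult.assoc)
      have "dist z w * C \<le> 1 / 2" using d C by (simp add: field_simps)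
      then have "norm (F 0 z) * (dist z w * C) \<le> norm (F 0 z) * (1 / 2)"
        by (intro mult_left_mono) auto
      then have "norm (F 0 z) \<le> norm (F 0 w) + norm (F 0 z) / 2"
        using 1 norm_triangle_sub[of "F 0 z" "F 0 w"] by linarith
      then have "norm (F 0 z) \<le> 2 * C" using C by linarith
      then have "norm (F 0 z) * (dist z w * C) \<le> 2 * C * (dist z w * C)"
        using C by (intro mult_right_mono) auto
      also have "\<dots> < e" using d C by (simp add: field_simps power2_eq_square)
      finally show "dist (F 0 z) (F 0 w) < e" using 1 by (simp add: dist_norm)
    qed
  qed
  then have "uniformly_continuous_on (cball 0 1) (F 0)"
    by (intro compact_uniformly_continuous) auto
  then obtain d where d: "d > 0"
    "\<And>z w. z \<in> cball 0 1 \<Longrightarrow> w \<in> cball 0 1 \<Longrightarrow> dist w z < d \<Longrightarrow> dist (F 0 w) (F 0 z) < 1/3"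
    unfolding uniformly_continuous_on_def by (metis zero_less_divide_1_iff zero_less_numeral)
  define r where "r = max 0 (1 - d / 2)"
  have r: "0 \<le> r" "r < 1" "1 - r < d" using d by (auto simp: r_def)
  \<comment> \<open>The passage from \<open>k\<close> to \<open>Suc k\<close> averages over the two
    square roots of the point, so the bound \<open>1/3\<close> survives, while the radius
    \<open>r ^ 2 ^ k\<close> is squared and tends to \<open>0\<close>.\<close>
  have key: "norm (F k (of_real (r ^ 2 ^ k) * u) - F k u) \<le> 1/3" if "cmod u = 1" for k u
    using that
  proof (induction k arbitrary: u)
    case 0
    have "dist (of_real r * u) u = cmod ((of_real r - 1) * u)" by (simp add: dist_norm algebra_simps)
    also have "\<dots> = \<bar>r - 1\<bar>" using 0 norm_of_real[of "r - 1", where 'a = complex] by (simp add: norm_mult)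
    also have "\<dots> = 1 - r" using r by simp
    finally have "dist (F 0 (of_real r * u)) (F 0 u) < 1/3"
      using r 0 by (intro d) (auto simp: norm_mult)
    then show ?case by (simp add: dist_norm)
  next
    case (Suc k)
    define v where "v = csqrt u"
    have v: "cmod v = 1" "u = v\<^sup>2" using Suc.prems by (simp_all add: v_def)
    let ?s = "complex_of_real (r ^ 2 ^ k)"
    have s: "cmod (?s * v) \<le> 1" using v r by (simp add: norm_mult norm_power power_le_one)
    have "of_real (r ^ 2 ^ Suc k) * u = (?s * v)\<^sup>2"
      by (simp add: v power_mult_distrib power_mult[symmetric] mult.commute)
    then have "F (Suc k) (of_real (r ^ 2 ^ Suc k) * u) = (1/2) *\<^sub>R (F k (?s * v) + F k (- (?s * v)))"
      using Fsq[OF s, of k] by (simp only:)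
    then have "F (Suc k) (of_real (r ^ 2 ^ Suc k) * u) - F (Suc k) u
      = (1/2) *\<^sub>R ((F k (?s * v) - F k v) + (F k (?s * (- v)) - F k (- v)))"
      using Fsq[of v k] v by (simp add: algebra_simps)
    also have "norm \<dots> \<le> (1/2) * (1/3 + 1/3)"
      unfolding norm_scaleR using Suc.IH[of v] Suc.IH[of "- v"] v
        norm_triangle_ineq[of "F k (?s * v) - F k v" "F k (?s * (- v)) - F k (- v)"]
      by simp
    finally show ?case by simp
  qed
  \<comment> \<open>At the tiny radius the inverse \<open>Y\<close> lies within \<open>1/9\<close>
    of \<open>1\<close>, hence the inverse \<open>Y'\<close> at radius \<open>1\<close> lies within
    \<open>1/9 + 1/3 = 4/9\<close>. Then \<open>1 - b\<close> has an inverse so close to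
    \<open>1\<close> that \<open>norm b\<close> is at most \<open>8/9\<close>, against
    \<open>norm b = 1\<close>.\<close>
  obtain N where N: "r ^ N < 1/10"
    using real_arch_pow_inv[of "1/10" r] r by auto
  have "r ^ 2 ^ N \<le> r ^ N" using r by (intro power_decreasing) (auto simp: less_imp_le)
  then have small: "r ^ 2 ^ N < 1/10" using N by simp
  define b where "b = a ^ 2 ^ N"
  have nb: "norm b = 1" unfolding b_def norm_power_selfadjoint[OF sa] by (simp add: n1)
  define Y where "Y = F N (of_real (r ^ 2 ^ N))"
  define Y' where "Y' = F N 1"
  have "is_inverse (1 - (r ^ 2 ^ N) *\<^sub>R b) Y"
    using Finv[of "of_real (r ^ 2 ^ N)" N] r by (simp add: Y_def b_def scaleC_of_real norm_power power_le_one del: of_real_power)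
  then have "Y - 1 = (r ^ 2 ^ N) *\<^sub>R (b * Y)" by (simp add: is_inverse_def algebra_simps)
  then have "norm (Y - 1) = r ^ 2 ^ N * norm (b * Y)" using r by simp
  also have "\<dots> \<le> (1/10) * norm Y"
    using norm_mult_ineq[of b Y] nb small r by (intro mult_mono) auto
  also have "\<dots> \<le> (1/10) * (norm (Y - 1) + 1)"
    using norm_triangle_ineq[of "Y - 1" 1] by simp
  finally have 1: "norm (Y - 1) \<le> 1/9" by simp
  have "norm (Y - Y') \<le> 1/3" using key[of 1 N] by (simp add: Y_def Y'_def)
  then have 2: "norm (Y' - 1) \<le> 4/9"
    using 1 norm_triangle_ineq4[of "Y - 1" "Y - Y'"] by simp
  have "is_inverse (1 - b) Y'" using Finv[of 1 N] by (simp add: Y'_def b_def scaleC_one)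
  then have "b = (Y' - 1) - b * (Y' - 1)" by (simp add: is_inverse_def algebra_simps)
  then have "norm b = norm ((Y' - 1) - b * (Y' - 1))" by (rule arg_cong)
  also have "\<dots> \<le> norm (Y' - 1) + norm (b * (Y' - 1))" by (rule norm_triangle_ineq4)
  also have "\<dots> \<le> norm (Y' - 1) + norm b * norm (Y' - 1)" by (intro add_left_mono norm_mult_ineq)
  finally have "norm b \<le> norm (Y' - 1) + norm b * norm (Y' - 1)" .
  then show False using nb 2 by simp
qed

text \<open>After scaling to norm \<open>1\<close>, a nonzero point \<open>w\<close> of the unit
  disc where invertibility fails puts \<open>norm a / w\<close> into the spectrum, and its modulus
  is at least \<open>norm a\<close>; \<open>spectrum_bound\<close> gives the converse. This replaces
  the spectral radius formula.\<close>

lemma spectrum_attains_norm: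
  fixes a :: "'a::cstar_algebra"
  assumes sa: "star a = a"
  shows "\<exists>z\<in>spectrum a. cmod z = norm a"
proof (cases "a = 0")
  case True
  have "\<not> invertible_elem (0::'a)" by (simp add: invertible_elem_def)
  then show ?thesis using True by (auto simp: spectrum_def intro!: bexI[of _ 0])
next
  case False
  define b where "b = inverse (norm a) *\<^sub>R a"
  have "star b = b" "norm b = 1" using sa False by (simp_all add: b_def star_scaleR)
  then obtain w where w: "cmod w \<le> 1" "\<not> invertible_elem (1 - w *\<^sub>C b)"
    using noninvertible_on_unit_disc by blast
  have w0: "w \<noteq> 0"
  proof
    assume "w = 0" then show False using w(2) by (auto simp: invertible_elem_def)
  qed
  define z where "z = of_real (norm a) / w"
  have z0: "z \<noteq> 0" "inverse z = w * of_real (inverse (norm a))" using w0 False by (simp_all add: z_def field_simps)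
  have eq: "z *\<^sub>C 1 - a = z *\<^sub>C (1 - w *\<^sub>C b)"
    using z0 by (simp add: b_def scaleR_scaleC scaleC_scaleC scaleC_diff_right z0(2)[symmetric] scaleC_one del: of_real_inverse)
  have z: "z \<in> spectrum a"
    unfolding spectrum_def mem_Collect_eq eq invertible_elem_scaleC_iff[OF z0(1)] by (rule w(2))
  have "norm a \<le> cmod z" using w(1) w0 by (simp add: z_def norm_divide field_simps mult_left_le)
  then show ?thesis using z spectrum_bound[OF z] by force
qed

text \<open>Arens' shift: after adding \<open>i t\<close> to \<open>a\<close> the squared norm is at
  most \<open>(norm a)^2 + t^2\<close>, whereas the squared modulus of the shifted spectral point
  contains \<open>t^2 + 2 t Im z\<close>. If \<open>Im z\<close> were not zero, a suitable
  \<open>t\<close> would break \<open>spectrum_bound\<close>.\<close>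

lemma spectrum_selfadjoint_real:
  fixes a :: "'a::cstar_algebra"
  assumes sa: "star a = a" and z: "z \<in> spectrum a"
  shows "Im z = 0"
proof (rule ccontr)
  assume ne: "Im z \<noteq> 0"
  have bound: "(Im z)\<^sup>2 + 2 * Im z * t \<le> (norm a)\<^sup>2" for t
  proof -
    let ?i = "complex_of_real t * \<i>"
    have eq: "(z + ?i) *\<^sub>C 1 - (a + ?i *\<^sub>C 1) = z *\<^sub>C 1 - a" by (simp add: scaleC_add_left)
    have "z + ?i \<in> spectrum (a + ?i *\<^sub>C 1)"
      using z unfolding spectrum_def mem_Collect_eq eq .
    then have "(cmod (z + ?i))\<^sup>2 \<le> (norm (a + ?i *\<^sub>C 1))\<^sup>2"
      by (intro power_mono spectrum_bound) auto
    also have "\<dots> = norm (star (a + ?i *\<^sub>C 1) * (a + ?i *\<^sub>C 1))" by (simp add: cstar_identity)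
    also have "star (a + ?i *\<^sub>C 1) * (a + ?i *\<^sub>C 1) = a * a + (t\<^sup>2) *\<^sub>R 1"
      by (simp add: sa star_add star_scaleC algebra_simps mult_scaleC_left mult_scaleC_right scaleC_scaleC
          scaleC_diff_right scaleR_scaleC power2_eq_square)
    also have "norm \<dots> \<le> (norm a)\<^sup>2 + t\<^sup>2"
      using norm_triangle_ineq[of "a * a" "t\<^sup>2 *\<^sub>R 1"] norm_mult_ineq[of a a] by (simp add: power2_eq_square)
    finally have "(Re z)\<^sup>2 + (Im z + t)\<^sup>2 \<le> (norm a)\<^sup>2 + t\<^sup>2" by (simp add: cmod_power2)
    then have "(Re z)\<^sup>2 + ((Im z)\<^sup>2 + 2 * Im z * t) \<le> (norm a)\<^sup>2" by (simp add: power2_sum)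
    then show ?thesis by (smt (verit) zero_le_power2)
  qed
  show False
    using bound[of "((norm a)\<^sup>2 + 1) / Im z"] ne by (simp add: add_pos_nonneg) (smt (verit) zero_le_power2)
qed

section \<open>Existence of the continuous functional calculus\<close>

definition peval :: "complex poly \<Rightarrow> 'a::cstar_algebra \<Rightarrow> 'a" where
  "peval p a = fold_coeffs (\<lambda>c x. c *\<^sub>C 1 + a * x) p 0"

lemma peval_0 [simp]: "peval 0 a = 0"
  by (simp add: peval_def)

lemma peval_pCons [simp]: "peval (pCons c p) a = c *\<^sub>C 1 + a * peval p a"
  by (cases "p = 0 \<and> c = 0") (auto simp: peval_def)

lemma peval_add: "peval (p + q) a = peval p a + peval q a"
  by (induction p q rule: poly_induct2) (simp_all add: scaleC_add_left algebra_simps)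

lemma peval_smult: "peval (smult c p) a = c *\<^sub>C peval p a"
  by (induction p) (simp_all add: scaleC_add_right scaleC_scaleC mult_scaleC_right)

lemma peval_minus: "peval (- p) a = - peval p a"
  using peval_smult[of "- 1" p a] by (simp add: scaleC_one)

lemma peval_diff: "peval (p - q) a = peval p a - peval q a"
  using peval_add[of p "- q" a] by (simp add: peval_minus)

lemma peval_mult: "peval (p * q) a = peval p a * peval q a"
  by (induction p)
    (simp_all add: peval_add peval_smult mult_scaleC_left algebra_simps)

lemma peval_star:
  "star a = a \<Longrightarrow> peval (map_poly cnj p) a = star (peval p a)"
proof (induction p)
  case (pCons c p)
  have "star (peval p a) * a = a * star (peval p a)"
  proof -
    have "peval q a * a = a * peval q a" for q
      using peval_mult[of q "[:0, 1:]" a] peval_mult[of "[:0, 1:]" q a]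
      by (simp add: scaleC_one mult.commute[of q])
    then show ?thesis using pCons by metis
  qed
  then show ?case
    using pCons by (simp add: map_poly_pCons star_add star_scaleC star_mult)
qed simp

text \<open>Over the complex numbers \<open>p\<close> splits. A root outside the spectrum
  contributes an invertible linear factor, which is divided off; a nonzero constant is invertible,
  so some root must lie in the spectrum.\<close>

lemma peval_noninvertible_root:
  "p \<noteq> 0 \<Longrightarrow> \<not> invertible_elem (peval p a) \<Longrightarrow> \<exists>z\<in>spectrum a. poly p z = 0"
proof (induction "degree p" arbitrary: p)
  case 0
  then obtain c where "p = [:c:]" by (metis degree_eq_zeroE)
  then show ?case
    using 0 invertible_elem_scaleC_iff[of c 1] by (auto simp: invertible_elem_def)
next
  case (Suc n)
  then have "\<not> constant (poly p)" by (simp add: constant_degree)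
  then obtain z where z: "poly p z = 0" using fundamental_theorem_of_algebra by blast
  then obtain q where p: "p = [:- z, 1:] * q" by (metis dvdE poly_eq_0_iff_dvd)
  show ?case
  proof (cases "z \<in> spectrum a")
    case False
    have "peval [:- z, 1:] a = - (z *\<^sub>C 1 - a)" by (simp add: scaleC_one)
    also have "\<dots> = (- 1) *\<^sub>C (z *\<^sub>C 1 - a)" by (simp add: scaleC_one)
    finally have "invertible_elem (peval [:- z, 1:] a)"
      using False invertible_elem_scaleC_iff[of "- 1" "z *\<^sub>C 1 - a"] unfolding spectrum_def by auto
    then have ni: "\<not> invertible_elem (peval q a)"
      using Suc.prems(2) invertible_elem_mult unfolding p peval_mult by blast
    have "q \<noteq> 0" using Suc.prems(1) p by auto
    have "degree p = degree [:- z, 1:] + degree q" unfolding p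
      by (rule degree_mult_eq) (use \<open>q \<noteq> 0\<close> in auto)
    then have "degree q = n" using Suc.hyps(2) by simp
    then show ?thesis using Suc.hyps(1)[of q] \<open>q \<noteq> 0\<close> ni p by auto
  qed (use z in auto)
qed

lemma poly_in_spectrum:
  assumes "z \<in> spectrum a"
  shows "poly p z \<in> spectrum (peval p a)"
proof (rule ccontr)
  assume "\<not> ?thesis"
  then have inv: "invertible_elem (poly p z *\<^sub>C 1 - peval p a)" by (simp add: spectrum_def)
  have "poly ([:poly p z:] - p) z = 0" by simp
  then obtain q where q: "[:poly p z:] - p = [:- z, 1:] * q" by (metis dvdE poly_eq_0_iff_dvd)
  have "[:poly p z:] - p = [:z, - 1:] * (- q)" unfolding q by (simp add: algebra_simps)
  then have "peval ([:poly p z:] - p) a = peval ([:z, - 1:] * (- q)) a" by simp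
  then have e: "poly p z *\<^sub>C 1 - peval p a = (z *\<^sub>C 1 - a) * peval (- q) a"
    unfolding peval_diff peval_mult by (simp add: scaleC_one)
  have "(z *\<^sub>C 1 - a) * peval (- q) a = peval ([:z, - 1:] * (- q)) a"
    unfolding peval_mult by (simp add: scaleC_one)
  also have "\<dots> = peval (- q) a * (z *\<^sub>C 1 - a)"
    unfolding mult.commute[of "[:z, - 1:]"] peval_mult by (simp add: scaleC_one)
  finally have "invertible_elem (z *\<^sub>C 1 - a)"
    using inv invertible_elem_of_commuting_product unfolding e by blast
  then show False using assms by (simp add: spectrum_def)
qed

lemma spectrum_nonempty: "star a = a \<Longrightarrow> spectrum a \<noteq> {}"
  using spectrum_attains_norm by auto

text \<open>Nonemptiness matters for a constant \<open>p\<close>: its value has a spectrum of one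
  point whatever \<open>a\<close> is.\<close>

lemma spectrum_peval:
  assumes "spectrum a \<noteq> {}"
  shows "spectrum (peval p a) = poly p ` spectrum a"
proof (intro equalityI subsetI)
  fix w assume "w \<in> spectrum (peval p a)"
  then have ni: "\<not> invertible_elem (peval ([:w:] - p) a)" by (simp add: spectrum_def peval_diff)
  show "w \<in> poly p ` spectrum a"
  proof (cases "[:w:] - p = 0")
    case True
    then have "p = [:w:]" by simp
    then show ?thesis using assms by auto
  next
    case False
    then show ?thesis using peval_noninvertible_root[OF False ni] by auto
  qed
qed (auto intro: poly_in_spectrum)

lemma poly_le_norm_peval: "z \<in> spectrum a \<Longrightarrow> cmod (poly p z) \<le> norm (peval p a)"
  by (intro spectrum_bound poly_in_spectrum)

text \<open>The element \<open>peval p a\<close> need not be self-adjoint, but its product with its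
  adjoint is, and equals the value of \<open>map_poly cnj p * p\<close>; the C*-identity takes the
  norm back. Polynomial evaluation is thus isometric for the supremum over the spectrum.\<close>

lemma norm_peval_attained:
  assumes sa: "star a = a"
  shows "\<exists>z\<in>spectrum a. cmod (poly p z) = norm (peval p a)"
proof -
  let ?q = "map_poly cnj p * p"
  have q: "peval ?q a = star (peval p a) * peval p a"
    using sa by (simp add: peval_mult peval_star)
  then have "star (peval ?q a) = peval ?q a" by (simp add: star_mult star_star)
  then obtain w where w: "w \<in> spectrum (peval ?q a)" "cmod w = norm (peval ?q a)"
    using spectrum_attains_norm by blast
  then obtain z where z: "z \<in> spectrum a" "w = poly ?q z"
    using spectrum_peval[OF spectrum_nonempty[OF sa], of ?q] by blast
  have "cnj z = z" using spectrum_selfadjoint_real[OF sa z(1)] by (simp add: complex_eq_iff)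
  then have "poly (map_poly cnj p) z = cnj (poly p z)" by (metis poly_cnj)
  then have "(cmod (poly p z))\<^sup>2 = (norm (peval p a))\<^sup>2"
    using w(2) z(2) unfolding q cstar_identity by (simp add: norm_mult power2_eq_square)
  then show ?thesis using z(1) by (auto simp: power2_eq_iff_nonneg)
qed

text \<open>A relation, since approximating polynomials are far from unique;
  \<open>cfc_limit_unique\<close> makes \<open>x\<close> a function of \<open>f\<close>. In this
  form the algebraic laws pass to the limit without fixing any approximants.\<close>

definition cfc_limit :: "'a::cstar_algebra \<Rightarrow> (complex \<Rightarrow> complex) \<Rightarrow> 'a \<Rightarrow> bool" where
  "cfc_limit a f x \<longleftrightarrow> (\<exists>P. uniform_limit (spectrum a) (\<lambda>n. poly (P n)) f sequentially
    \<and> (\<lambda>n. peval (P n) a) \<longlonglongrightarrow> x)"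

lemma cfc_limit_peval: "cfc_limit a (poly p) (peval p a)"
  unfolding cfc_limit_def by (intro exI[of _ "\<lambda>_. p"]) (simp add: uniform_limit_const)

lemma cfc_limit_add: "cfc_limit a f x \<Longrightarrow> cfc_limit a g y \<Longrightarrow> cfc_limit a (\<lambda>z. f z + g z) (x + y)"
proof -
  assume "cfc_limit a f x" "cfc_limit a g y"
  then obtain P Q where
    "uniform_limit (spectrum a) (\<lambda>n. poly (P n)) f sequentially" "(\<lambda>n. peval (P n) a) \<longlonglongrightarrow> x"
    "uniform_limit (spectrum a) (\<lambda>n. poly (Q n)) g sequentially" "(\<lambda>n. peval (Q n) a) \<longlonglongrightarrow> y"
    by (auto simp: cfc_limit_def)
  moreover have "(\<lambda>n. poly (P n + Q n)) = (\<lambda>n z. poly (P n) z + poly (Q n) z)" by (intro ext) simp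
  ultimately show ?thesis unfolding cfc_limit_def
    by (intro exI[of _ "\<lambda>n. P n + Q n"]) (auto simp: peval_add intro: uniform_limit_add tendsto_add)
qed

lemma cfc_limit_mult:
  assumes f: "cfc_limit a f x" and g: "cfc_limit a g y"
    and cf: "continuous_on (spectrum a) f" and cg: "continuous_on (spectrum a) g"
  shows "cfc_limit a (\<lambda>z. f z * g z) (x * y)"
proof -
  obtain P Q where
    "uniform_limit (spectrum a) (\<lambda>n. poly (P n)) f sequentially" "(\<lambda>n. peval (P n) a) \<longlonglongrightarrow> x"
    "uniform_limit (spectrum a) (\<lambda>n. poly (Q n)) g sequentially" "(\<lambda>n. peval (Q n) a) \<longlonglongrightarrow> y"
    using f g by (auto simp: cfc_limit_def)
  moreover have "bounded (f ` spectrum a)" "bounded (g ` spectrum a)"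
    using cf cg compact_spectrum by (auto intro: compact_imp_bounded compact_continuous_image)
  moreover have "(\<lambda>n. poly (P n * Q n)) = (\<lambda>n z. poly (P n) z * poly (Q n) z)" by (intro ext) simp
  ultimately show ?thesis unfolding cfc_limit_def
    by (intro exI[of _ "\<lambda>n. P n * Q n"])
      (auto simp: peval_mult intro: uniform_lim_mult tendsto_mult)
qed

lemma cfc_limit_scaleC:
  assumes "cfc_limit a f x"
  shows "cfc_limit a (\<lambda>z. c * f z) (c *\<^sub>C x)"
proof -
  obtain P where
    "uniform_limit (spectrum a) (\<lambda>n. poly (P n)) f sequentially" "(\<lambda>n. peval (P n) a) \<longlonglongrightarrow> x"
    using assms by (auto simp: cfc_limit_def)
  moreover have "(\<lambda>n. poly (smult c (P n))) = (\<lambda>n z. c * poly (P n) z)" by (intro ext) simp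
  ultimately show ?thesis unfolding cfc_limit_def
    by (intro exI[of _ "\<lambda>n. smult c (P n)"])
      (auto simp: peval_smult intro: bounded_linear.uniform_limit[OF bounded_linear_mult_right]
        bounded_linear.tendsto[OF bounded_linear_scaleC])
qed

lemma cfc_limit_star:
  assumes "cfc_limit a f x" and sa: "star a = a"
  shows "cfc_limit a (\<lambda>z. cnj (f z)) (star x)"
proof -
  obtain P where P: "uniform_limit (spectrum a) (\<lambda>n. poly (P n)) f sequentially"
    and x: "(\<lambda>n. peval (P n) a) \<longlonglongrightarrow> x"
    using assms by (auto simp: cfc_limit_def)
  have "cnj z = z" if "z \<in> spectrum a" for z
    using spectrum_selfadjoint_real[OF sa that] by (simp add: complex_eq_iff)
  then have pc: "poly (map_poly cnj p) z = cnj (poly p z)" if "z \<in> spectrum a" for z p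
    using that by (metis poly_cnj)
  have "uniform_limit (spectrum a) (\<lambda>n. poly (map_poly cnj (P n))) (\<lambda>z. cnj (f z)) sequentially"
  proof -
    have "dist (poly (map_poly cnj p) z) (cnj (f z)) = dist (poly p z) (f z)" if "z \<in> spectrum a" for z p
      unfolding pc[OF that] dist_norm complex_cnj_diff[symmetric] by (rule complex_mod_cnj)
    then show ?thesis using P unfolding uniform_limit_iff by (simp cong: ball_cong)
  qed
  moreover have "(\<lambda>n. peval (map_poly cnj (P n)) a) \<longlonglongrightarrow> star x"
    unfolding peval_star[OF sa] by (rule bounded_linear.tendsto[OF bounded_linear_star x])
  ultimately show ?thesis by (auto simp: cfc_limit_def)
qed

lemma cfc_limit_norm_lower:
  assumes "cfc_limit a f x" "z \<in> spectrum a"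
  shows "cmod (f z) \<le> norm x"
proof -
  obtain P where P: "uniform_limit (spectrum a) (\<lambda>n. poly (P n)) f sequentially"
    and x: "(\<lambda>n. peval (P n) a) \<longlonglongrightarrow> x"
    using assms by (auto simp: cfc_limit_def)
  have "(\<lambda>n. poly (P n) z) \<longlonglongrightarrow> f z" using tendsto_uniform_limitI[OF P assms(2)] .
  then show ?thesis
    using x poly_le_norm_peval[OF assms(2)]
    by (intro LIMSEQ_le[of "\<lambda>n. cmod (poly (P n) z)" _ "\<lambda>n. norm (peval (P n) a)"] tendsto_norm) auto
qed

text \<open>Each approximant takes its norm at a spectral point, where it is close to
  \<open>f\<close>. Applied to a difference with \<open>c = 0\<close>, this yields
  uniqueness.\<close>

lemma cfc_limit_norm_upper:
  assumes "cfc_limit a f x" and sa: "star a = a" and c: "\<And>z. z \<in> spectrum a \<Longrightarrow> cmod (f z) \<le> c"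
  shows "norm x \<le> c"
proof (rule field_le_epsilon)
  fix e :: real assume e: "e > 0"
  obtain P where P: "uniform_limit (spectrum a) (\<lambda>n. poly (P n)) f sequentially"
    and x: "(\<lambda>n. peval (P n) a) \<longlonglongrightarrow> x"
    using assms by (auto simp: cfc_limit_def)
  have "\<forall>\<^sub>F n in sequentially. norm (peval (P n) a) \<le> c + e"
    using uniform_limitD[OF P e]
  proof eventually_elim
    case (elim n)
    obtain z where z: "z \<in> spectrum a" "cmod (poly (P n) z) = norm (peval (P n) a)"
      using norm_peval_attained[OF sa] by blast
    show ?case using elim[rule_format, OF z(1)] c[OF z(1)] z(2) norm_triangle_sub[of "poly (P n) z" "f z"]
      by (simp add: dist_norm)
  qed
  then show "norm x \<le> c + e"
    using tendsto_upperbound[OF tendsto_norm[OF x]] by simp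
qed

lemma cfc_limit_cong:
  assumes "cfc_limit a f x" "\<And>z. z \<in> spectrum a \<Longrightarrow> f z = g z"
  shows "cfc_limit a g x"
proof -
  have "uniform_limit (spectrum a) P g F \<longleftrightarrow> uniform_limit (spectrum a) P f F" for P :: "nat \<Rightarrow> complex \<Rightarrow> complex" and F
    unfolding uniform_limit_iff using assms(2) by (simp cong: ball_cong)
  then show ?thesis using assms(1) unfolding cfc_limit_def by simp
qed

lemma cfc_limit_unique:
  assumes "cfc_limit a f x" "cfc_limit a f y" "star a = a"
  shows "x = y"
proof -
  have "cfc_limit a (\<lambda>z. f z + (- 1) * f z) (x + (- 1) *\<^sub>C y)"
    by (intro cfc_limit_add cfc_limit_scaleC assms)
  then have "norm (x + (- 1) *\<^sub>C y) \<le> 0"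
    by (rule cfc_limit_norm_upper) (simp_all add: assms)
  then show ?thesis by (simp add: scaleC_one)
qed

section \<open>Polynomial approximation on compact sets of the real line\<close>

lemma real_polynomial_function_imp_poly:
  fixes g :: "real \<Rightarrow> real"
  assumes "real_polynomial_function g"
  shows "\<exists>p. \<forall>x. poly p (complex_of_real x) = complex_of_real (g x)"
  using assms
proof induction
  case (linear f)
  have fx: "complex_of_real (f x) = of_real x * of_real (f 1)" for x
    using linear_scale[OF bounded_linear.linear[OF linear], of x 1] unfolding of_real_mult[symmetric] by simp
  have "poly [:0, complex_of_real (f 1):] (of_real x) = of_real (f x)" for x
    unfolding fx[of x] by simp
  then show ?case by blast
next
  case (const c)
  then show ?case by (intro exI[of _ "[:complex_of_real c:]"]) simp
next
  case (add f g)
  then show ?case by (metis poly_add of_real_add)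
next
  case (mult f g)
  then show ?case by (metis poly_mult of_real_mult)
qed

text \<open>On the real axis the real and the imaginary part of \<open>f\<close> are functions of
  one real variable, so the real Weierstrass theorem applies to each with error
  \<open>e / 2\<close>.\<close>

lemma poly_approximation:
  assumes S: "compact S" "\<And>z. z \<in> S \<Longrightarrow> Im z = 0" and f: "continuous_on S f" and e: "e > 0"
  shows "\<exists>p. \<forall>z\<in>S. cmod (poly p z - f z) < e"
proof -
  let ?T = "Re ` S"
  have T: "compact ?T" using S(1) by (intro compact_continuous_image continuous_intros) auto
  have SR: "complex_of_real (Re z) = z" if "z \<in> S" for z using S(2)[OF that] by (simp add: complex_eq_iff)
  then have im: "of_real ` ?T \<subseteq> S" by auto
  have cf: "continuous_on ?T (\<lambda>x. f (of_real x))"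
    using im by (intro continuous_on_compose2[OF f]) (auto intro: continuous_intros)
  have ex: "\<exists>p. \<forall>x\<in>?T. cmod (poly p (of_real x) - of_real (u x)) < e / 2"
    if u: "continuous_on ?T u" for u :: "real \<Rightarrow> real"
  proof -
    obtain g where g: "real_polynomial_function g" "\<And>x. x \<in> ?T \<Longrightarrow> \<bar>u x - g x\<bar> < e / 2"
      using Stone_Weierstrass_real_polynomial_function[OF T u half_gt_zero[OF e]] by metis
    obtain p where p: "\<And>x. poly p (complex_of_real x) = complex_of_real (g x)"
      using real_polynomial_function_imp_poly[OF g(1)] by auto
    have "cmod (poly p (of_real x) - of_real (u x)) < e / 2" if "x \<in> ?T" for x
      using g(2)[OF that] p[of x] norm_of_real[of "g x - u x", where 'a = complex]
      by (simp add: abs_minus_commute)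
    then show ?thesis by blast
  qed
  obtain p q where p: "\<forall>x\<in>?T. cmod (poly p (of_real x) - of_real (Re (f (of_real x)))) < e / 2"
    and q: "\<forall>x\<in>?T. cmod (poly q (of_real x) - of_real (Im (f (of_real x)))) < e / 2"
    using ex[OF continuous_on_Re[OF cf]] ex[OF continuous_on_Im[OF cf]] by blast
  show ?thesis
  proof (intro exI ballI)
    fix z assume z: "z \<in> S"
    have "poly (p + smult \<i> q) z - f z
      = (poly p z - of_real (Re (f z))) + \<i> * (poly q z - of_real (Im (f z)))"
      by (subst complex_eq[of "f z"]) (simp add: algebra_simps)
    also have "cmod \<dots> \<le> cmod (poly p z - of_real (Re (f z))) + cmod (poly q z - of_real (Im (f z)))"
      using norm_triangle_ineq[of "poly p z - of_real (Re (f z))" "\<i> * (poly q z - of_real (Im (f z)))"]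
      by (simp add: norm_mult)
    also have "\<dots> < e / 2 + e / 2"
      using p q z SR[OF z] by (intro add_strict_mono) force+
    finally show "cmod (poly (p + smult \<i> q) z - f z) < e" by simp
  qed
qed

lemma cfc_limit_exists:
  assumes sa: "star a = a" and f: "continuous_on (spectrum a) f"
  shows "\<exists>x. cfc_limit a f x"
proof -
  have "\<exists>p. \<forall>z\<in>spectrum a. cmod (poly p z - f z) < inverse (real (Suc n))" for n
    using poly_approximation[OF compact_spectrum spectrum_selfadjoint_real[OF sa] f] by simp
  then obtain P where P: "\<And>n z. z \<in> spectrum a \<Longrightarrow> cmod (poly (P n) z - f z) < inverse (real (Suc n))"
    by metis
  have u: "uniform_limit (spectrum a) (\<lambda>n. poly (P n)) f sequentially"
  proof (rule uniform_limitI)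
    fix e :: real assume "e > 0"
    then have "\<forall>\<^sub>F n in sequentially. inverse (real (Suc n)) < e"
      using LIMSEQ_inverse_real_of_nat by (metis order_tendstoD(2))
    then show "\<forall>\<^sub>F n in sequentially. \<forall>z\<in>spectrum a. dist (poly (P n) z) (f z) < e"
      by eventually_elim (metis P dist_norm less_trans)
  qed
  \<comment> \<open>The difference of two approximants takes its norm at a spectral point, where
    both are close to \<open>f\<close>.\<close>
  have "Cauchy (\<lambda>n. peval (P n) a)"
  proof (rule metric_CauchyI)
    fix e :: real assume e: "e > 0"
    obtain N where N: "inverse (real (Suc N)) < e / 2"
      using reals_Archimedean[of "e / 2"] e by auto
    show "\<exists>M. \<forall>m\<ge>M. \<forall>n\<ge>M. dist (peval (P m) a) (peval (P n) a) < e"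
    proof (intro exI allI impI)
      fix m n assume mn: "m \<ge> N" "n \<ge> N"
      obtain z where z: "z \<in> spectrum a" "cmod (poly (P m - P n) z) = norm (peval (P m - P n) a)"
        using norm_peval_attained[OF sa] by blast
      have "inverse (real (Suc k)) \<le> inverse (real (Suc N))" if "k \<ge> N" for k
        using that by (intro le_imp_inverse_le) auto
      then have "cmod (poly (P k) z - f z) < e / 2" if "k \<ge> N" for k
        using P[OF z(1), of k] N that by (meson order_le_less_trans order_less_trans)
      from this[OF mn(1)] this[OF mn(2)]
      have "cmod (poly (P m) z - poly (P n) z) < e"
        using norm_triangle_ineq4[of "poly (P m) z - f z" "poly (P n) z - f z"] by simp
      then show "dist (peval (P m) a) (peval (P n) a) < e"
        using z(2) by (simp add: dist_norm peval_diff)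
    qed
  qed
  then show ?thesis using u unfolding cfc_limit_def by (metis Cauchy_convergent convergentD)
qed

theorem continuous_functional_calculus_exists:
  fixes a :: "'a::cstar_algebra"
  assumes sa: "star a = a"
  shows "\<exists>\<Phi>. continuous_functional_calculus a \<Phi>"
proof -
  define \<Phi> where "\<Phi> f = (THE x. cfc_limit a f x)" for f
  have lim: "cfc_limit a f (\<Phi> f)" if f: "continuous_on (spectrum a) f" for f
    unfolding \<Phi>_def
    using cfc_limit_exists[OF sa f] cfc_limit_unique[OF _ _ sa, of f] by (metis theI')
  have eq: "\<Phi> f = x" if "cfc_limit a f x" for f x
    unfolding \<Phi>_def using that cfc_limit_unique[OF _ _ sa, of f] by blast
  have "continuous_functional_calculus a \<Phi>"
  proof
    fix f g :: "complex \<Rightarrow> complex" assume f: "continuous_on (spectrum a) f"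
    show "\<Phi> (\<lambda>z. c * f z) = c *\<^sub>C \<Phi> f" for c by (intro eq cfc_limit_scaleC lim f)
    show "\<Phi> (\<lambda>z. cnj (f z)) = star (\<Phi> f)" by (intro eq cfc_limit_star lim f sa)
    have le: "cmod (f z) \<le> norm (\<Phi> f)" if "z \<in> spectrum a" for z
      by (rule cfc_limit_norm_lower[OF lim[OF f] that])
    show "norm (\<Phi> f) = (SUP z\<in>spectrum a. cmod (f z))"
    proof (rule antisym)
      have "bdd_above ((\<lambda>z. cmod (f z)) ` spectrum a)" using le by (auto intro!: bdd_aboveI2)
      then show "norm (\<Phi> f) \<le> (SUP z\<in>spectrum a. cmod (f z))"
        by (intro cfc_limit_norm_upper[OF lim[OF f] sa] cSUP_upper)
      show "(SUP z\<in>spectrum a. cmod (f z)) \<le> norm (\<Phi> f)"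
        using spectrum_nonempty[OF sa] le by (rule cSUP_least)
    qed
    assume g: "continuous_on (spectrum a) g"
    show "\<Phi> (\<lambda>z. f z + g z) = \<Phi> f + \<Phi> g" by (intro eq cfc_limit_add lim f g)
    show "\<Phi> (\<lambda>z. f z * g z) = \<Phi> f * \<Phi> g" by (intro eq cfc_limit_mult lim f g)
  next
    show "\<Phi> (\<lambda>z. 1) = 1"
      using eq[OF cfc_limit_cong[OF cfc_limit_peval[of a "[:1:]"]], of "\<lambda>z. 1"] by (simp add: scaleC_one)
    show "\<Phi> (\<lambda>z. z) = a"
      using eq[OF cfc_limit_cong[OF cfc_limit_peval[of a "[:0, 1:]"]], of "\<lambda>z. z"] by (simp add: scaleC_one)
  qed
  then show ?thesis by blast
qed

section \<open>Real functional calculus of self-adjoint elements\<close>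

lemma cfc_continuous_functional_calculus:
  assumes "star a = a"
  shows "continuous_functional_calculus a (\<lambda>f. cfc f a)"
  using someI_ex[OF continuous_functional_calculus_exists[OF assms]] by (simp add: cfc_def)

lemma cfc_norm_lower:
  assumes sa: "star a = a" and f: "continuous_on (spectrum a) f" and z: "z \<in> spectrum a"
  shows "cmod (f z) \<le> norm (cfc f a)"
proof -
  interpret continuous_functional_calculus a "\<lambda>f. cfc f a"
    by (rule cfc_continuous_functional_calculus[OF sa])
  have "compact ((\<lambda>z. cmod (f z)) ` spectrum a)"
    by (intro compact_continuous_image continuous_on_norm f compact_spectrum)
  then show ?thesis
    unfolding isometric[OF f] using z
    by (intro cSUP_upper bounded_imp_bdd_above compact_imp_bounded)
qed

lemma cfc_norm_upper:
  assumes sa: "star a = a" and f: "continuous_on (spectrum a) f"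
    and c: "\<And>z. z \<in> spectrum a \<Longrightarrow> cmod (f z) \<le> c"
  shows "norm (cfc f a) \<le> c"
proof -
  interpret continuous_functional_calculus a "\<lambda>f. cfc f a"
    by (rule cfc_continuous_functional_calculus[OF sa])
  show ?thesis
    unfolding isometric[OF f] using c spectrum_nonempty[OF sa] by (intro cSUP_least)
qed

lemma cfc_cong:
  assumes sa: "star a = a" and f: "continuous_on (spectrum a) f"
    and eq: "\<And>z. z \<in> spectrum a \<Longrightarrow> f z = g z"
  shows "cfc f a = cfc g a"
proof -
  interpret continuous_functional_calculus a "\<lambda>f. cfc f a"
    by (rule cfc_continuous_functional_calculus[OF sa])
  have g: "continuous_on (spectrum a) g" using f continuous_on_cong[of "spectrum a" _ f g] eq by auto
  have g': "continuous_on (spectrum a) (\<lambda>z. (- 1) * g z)" by (intro continuous_intros g)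
  have "cfc (\<lambda>z. f z + (- 1) * g z) a = cfc f a + (- 1) *\<^sub>C cfc g a"
    unfolding add[OF f g'] scaleC[OF g] ..
  moreover have "norm (cfc (\<lambda>z. f z + (- 1) * g z) a) \<le> 0"
    by (rule cfc_norm_upper[OF sa]) (use eq in \<open>auto intro!: continuous_intros f g\<close>)
  ultimately show ?thesis by (simp add: scaleC_one)
qed

definition rspec :: "'a::cstar_algebra \<Rightarrow> real set" where
  "rspec a = Re ` spectrum a"

text \<open>\<open>Re\<close> extends a real function to the complex plane and changes nothing on
  the spectrum of a self-adjoint element. Real functions suffice from here on, and for continuous
  ones the value is again self-adjoint.\<close>

definition rcf :: "(real \<Rightarrow> real) \<Rightarrow> 'a::cstar_algebra \<Rightarrow> 'a" where
  "rcf f a = cfc (\<lambda>z. complex_of_real (f (Re z))) a"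

lemma compact_rspec: "compact (rspec a)"
  unfolding rspec_def by (intro compact_continuous_image compact_spectrum continuous_intros)

lemma rspec_nonempty: "star a = a \<Longrightarrow> rspec a \<noteq> {}"
  by (simp add: rspec_def spectrum_nonempty)

lemma spectrum_eq_rspec: "star a = a \<Longrightarrow> spectrum a = of_real ` rspec a"
  using spectrum_selfadjoint_real[of a] unfolding rspec_def image_image
  by (simp add: complex_eq_iff image_iff set_eq_iff) (metis complex.collapse complex_of_real_def)

lemma rspec_iff: "star a = a \<Longrightarrow> x \<in> rspec a \<longleftrightarrow> \<not> invertible_elem (x *\<^sub>R 1 - a)"
proof -
  assume "star a = a"
  from spectrum_eq_rspec[OF this] have "of_real x \<in> spectrum a \<longleftrightarrow> x \<in> rspec a" by auto
  then show ?thesis by (simp add: spectrum_def scaleC_of_real)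
qed

context
  fixes a :: "'a::cstar_algebra"
  assumes sa: "star a = a"
begin

interpretation continuous_functional_calculus a "\<lambda>f. cfc f a"
  by (rule cfc_continuous_functional_calculus[OF sa])

lemma continuous_on_rspec_lift:
  "continuous_on (rspec a) f \<Longrightarrow> continuous_on (spectrum a) (\<lambda>z. complex_of_real (f (Re z)))"
  unfolding rspec_def by (intro continuous_on_of_real continuous_on_compose2[of _ f _ Re]) (auto intro: continuous_intros)

lemma rcf_cong:
  assumes "continuous_on (rspec a) f" "\<And>x. x \<in> rspec a \<Longrightarrow> f x = g x"
  shows "rcf f a = rcf g a"
  unfolding rcf_def using assms
  by (intro cfc_cong sa continuous_on_rspec_lift) (auto simp: rspec_def)

lemma rcf_add:
  assumes "continuous_on (rspec a) f" "continuous_on (rspec a) g"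
  shows "rcf (\<lambda>x. f x + g x) a = rcf f a + rcf g a"
  unfolding rcf_def of_real_add using assms by (intro add continuous_on_rspec_lift)

lemma rcf_mult:
  assumes "continuous_on (rspec a) f" "continuous_on (rspec a) g"
  shows "rcf (\<lambda>x. f x * g x) a = rcf f a * rcf g a"
  unfolding rcf_def of_real_mult using assms by (intro mult continuous_on_rspec_lift)

lemma rcf_scaleR:
  assumes "continuous_on (rspec a) f"
  shows "rcf (\<lambda>x. c * f x) a = c *\<^sub>R rcf f a"
  unfolding rcf_def of_real_mult scaleR_scaleC using assms by (intro scaleC continuous_on_rspec_lift)

lemma rcf_minus: "continuous_on (rspec a) f \<Longrightarrow> rcf (\<lambda>x. - f x) a = - rcf f a"
  using rcf_scaleR[of f "- 1"] by simp

lemma rcf_diff: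
  assumes "continuous_on (rspec a) f" "continuous_on (rspec a) g"
  shows "rcf (\<lambda>x. f x - g x) a = rcf f a - rcf g a"
  using rcf_add[of f "\<lambda>x. - g x"] rcf_minus[of g] assms by (simp add: continuous_on_minus)

lemma rcf_one: "rcf (\<lambda>x. 1) a = 1"
  using one by (simp add: rcf_def)

lemma rcf_const: "rcf (\<lambda>x. c) a = c *\<^sub>R 1"
  using rcf_scaleR[of "\<lambda>x. 1" c] by (simp add: rcf_one)

lemma rcf_ident: "rcf (\<lambda>x. x) a = a"
proof -
  have "cfc (\<lambda>z. complex_of_real (Re z)) a = cfc (\<lambda>z. z) a"
    using spectrum_selfadjoint_real[OF sa]
    by (intro cfc_cong sa) (auto simp: complex_eq_iff intro!: continuous_intros)
  then show ?thesis by (simp add: rcf_def ident)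
qed

lemma rcf_affine: "rcf (\<lambda>x. c * x + d) a = c *\<^sub>R a + d *\<^sub>R 1"
  by (simp add: rcf_add rcf_scaleR rcf_const rcf_ident continuous_intros)

lemma rcf_sum:
  "finite I \<Longrightarrow> (\<And>i. i \<in> I \<Longrightarrow> continuous_on (rspec a) (f i)) \<Longrightarrow>
    rcf (\<lambda>x. \<Sum>i\<in>I. f i x) a = (\<Sum>i\<in>I. rcf (f i) a)"
proof (induction I rule: finite_induct)
  case empty
  then show ?case using rcf_const[of 0] by simp
next
  case (insert i I)
  then show ?case using rcf_add[of "f i" "\<lambda>x. \<Sum>i\<in>I. f i x"] by (simp add: continuous_on_sum)
qed

lemma star_rcf: "continuous_on (rspec a) f \<Longrightarrow> star (rcf f a) = rcf f a"
  using star[OF continuous_on_rspec_lift, of f] by (simp add: rcf_def)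

lemma rcf_norm_lower: "continuous_on (rspec a) f \<Longrightarrow> x \<in> rspec a \<Longrightarrow> \<bar>f x\<bar> \<le> norm (rcf f a)"
  using cfc_norm_lower[OF sa continuous_on_rspec_lift] by (auto simp: rspec_def rcf_def)

lemma rcf_norm_upper:
  "continuous_on (rspec a) f \<Longrightarrow> (\<And>x. x \<in> rspec a \<Longrightarrow> \<bar>f x\<bar> \<le> c) \<Longrightarrow> norm (rcf f a) \<le> c"
  unfolding rcf_def by (intro cfc_norm_upper[OF sa] continuous_on_rspec_lift) (auto simp: rspec_def)

lemma rcf_is_inverse:
  assumes f: "continuous_on (rspec a) f" and nz: "\<And>x. x \<in> rspec a \<Longrightarrow> f x \<noteq> 0"
  shows "is_inverse (rcf f a) (rcf (\<lambda>x. inverse (f x)) a)"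
proof -
  have g: "continuous_on (rspec a) (\<lambda>x. inverse (f x))"
    using nz by (intro continuous_on_inverse f) auto
  have "rcf (\<lambda>x. f x * inverse (f x)) a = rcf (\<lambda>x. 1) a" "rcf (\<lambda>x. inverse (f x) * f x) a = rcf (\<lambda>x. 1) a"
    by (intro rcf_cong continuous_on_mult f g; simp add: nz)+
  then show ?thesis using f g by (simp add: rcf_mult rcf_one is_inverse_def)
qed

lemma rspec_rcf:
  assumes f: "continuous_on (rspec a) f"
  shows "rspec (rcf f a) = f ` rspec a"
proof (intro equalityI subsetI)
  fix y assume y: "y \<in> rspec (rcf f a)"
  show "y \<in> f ` rspec a"
  proof (rule ccontr)
    assume "y \<notin> f ` rspec a"
    then have "invertible_elem (rcf (\<lambda>x. y - f x) a)"
      using rcf_is_inverse[of "\<lambda>x. y - f x"] f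
      by (auto simp: invertible_elem_iff continuous_on_diff)
    then show False using y f rspec_iff[OF star_rcf[OF f]] by (simp add: rcf_diff rcf_const)
  qed
next
  fix y assume "y \<in> f ` rspec a"
  then obtain x0 where x0: "x0 \<in> rspec a" "y = f x0" by auto
  show "y \<in> rspec (rcf f a)"
  proof (rule ccontr)
    assume "y \<notin> rspec (rcf f a)"
    then obtain b where b: "b * (y *\<^sub>R 1 - rcf f a) = 1"
      unfolding rspec_iff[OF star_rcf[OF f]] by (auto simp: invertible_elem_def)
    \<comment> \<open>The tent function \<open>g\<close> is \<open>1\<close> at \<open>x0\<close>
      and vanishes where the distance of \<open>y\<close> and \<open>f x\<close> exceeds
      \<open>1 / K\<close>. So \<open>y - f\<close> nearly annihilates it, which an element with a
      left inverse of norm below \<open>K\<close> cannot do.\<close>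
    define K where "K = norm b + 1"
    have K: "K > 0" by (simp add: K_def add_nonneg_pos)
    define g where "g x = max 0 (1 - K * \<bar>y - f x\<bar>)" for x
    have g: "continuous_on (rspec a) g" unfolding g_def by (intro continuous_intros f)
    have yf: "continuous_on (rspec a) (\<lambda>x. y - f x)" by (intro continuous_intros f)
    have "norm (rcf (\<lambda>x. (y - f x) * g x) a) \<le> 1 / K"
    proof (rule rcf_norm_upper[OF continuous_on_mult[OF yf g]])
      fix x
      show "\<bar>(y - f x) * g x\<bar> \<le> 1 / K"
      proof (cases "K * \<bar>y - f x\<bar> \<le> 1")
        case True
        have "\<bar>y - f x\<bar> * g x \<le> \<bar>y - f x\<bar> * 1" using K by (intro mult_left_mono) (auto simp: g_def)
        also have "\<dots> \<le> 1 / K" using True K by (simp add: field_simps)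
        finally show ?thesis by (simp add: abs_mult g_def)
      qed (use K in \<open>simp add: g_def\<close>)
    qed
    moreover have "1 \<le> norm (rcf g a)"
      using rcf_norm_lower[OF g x0(1)] x0(2) by (simp add: g_def)
    moreover have "rcf g a = b * rcf (\<lambda>x. (y - f x) * g x) a"
      using b yf g f by (simp add: rcf_mult rcf_diff rcf_const flip: mult.assoc)
    then have "norm (rcf g a) \<le> norm b * norm (rcf (\<lambda>x. (y - f x) * g x) a)"
      using norm_mult_ineq by metis
    ultimately have "1 \<le> norm b * (1 / K)"
      by (meson mult_left_mono norm_ge_zero order_trans)
    then show False using K by (simp add: K_def field_simps)
  qed
qed

end

text \<open>Both sides are linear and multiplicative in \<open>g\<close>, so they agree for
  polynomials by induction; uniform approximation on the image of the spectrum, which is the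
  spectrum of \<open>rcf f a\<close>, extends this to continuous \<open>g\<close>.\<close>

lemma rcf_comp:
  assumes sa: "star a = a" and f: "continuous_on (rspec a) f" and g: "continuous_on (f ` rspec a) g"
  shows "rcf g (rcf f a) = rcf (\<lambda>x. g (f x)) a"
proof -
  let ?b = "rcf f a"
  note sb = star_rcf[OF sa f]
  have gf: "continuous_on (rspec a) (\<lambda>x. g (f x))"
    by (rule continuous_on_compose2[OF g f]) auto

  have norm0: "norm (rcf g ?b - rcf (\<lambda>x. g (f x)) a) \<le> e" if e: "e > 0" for e
  proof -
    have "compact (f ` rspec a)" by (intro compact_continuous_image f compact_rspec)
    then obtain p where p: "real_polynomial_function p" "\<And>y. y \<in> f ` rspec a \<Longrightarrow> \<bar>g y - p y\<bar> < e / 2"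
      using Stone_Weierstrass_real_polynomial_function[OF _ g half_gt_zero[OF e]] by metis
    have cont: "continuous_on S q" if "real_polynomial_function q" for S and q :: "real \<Rightarrow> real"
      using that by (simp add: continuous_on_polymonial_function real_polynomial_function_eq)
    have cont': "continuous_on (rspec a) (\<lambda>x. q (f x))" if "real_polynomial_function q" for q :: "real \<Rightarrow> real"
      using that by (intro continuous_on_compose2[OF cont[of q UNIV] f]) auto
    have peq: "rcf q ?b = rcf (\<lambda>x. q (f x)) a" if "real_polynomial_function q" for q
      using that
    proof induction
      case (linear h)
      have "h x = h 1 * x" for x
        using linear_scale[OF bounded_linear.linear[OF linear], of x 1] by (simp only: real_scaleR_def mult_1_right mult.commute[of x])
      then have h: "h = (\<lambda>x. h 1 * x)" by (rule ext)
      show ?case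
        using rcf_scaleR[OF sa f, of "h 1"] rcf_scaleR[OF sb, of "\<lambda>x. x" "h 1"] rcf_ident[OF sb]
        by (subst (1 2) h) (simp only: continuous_on_id)
    next
      case (const c)
      show ?case by (simp add: rcf_const[OF sa] rcf_const[OF sb])
    next
      case (add p q)
      then show ?case
        by (simp add: rcf_add[OF sa cont' cont'] rcf_add[OF sb cont cont])
    next
      case (mult p q)
      then show ?case
        by (simp add: rcf_mult[OF sa cont' cont'] rcf_mult[OF sb cont cont])
    qed
    have gb: "continuous_on (rspec ?b) g" using g rspec_rcf[OF sa f] by simp
    have "norm (rcf (\<lambda>x. g x - p x) ?b) \<le> e / 2"
      using p(2) by (intro rcf_norm_upper[OF sb] continuous_on_diff gb cont p(1))
        (auto simp: rspec_rcf[OF sa f] less_imp_le)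
    moreover have "norm (rcf (\<lambda>x. g (f x) - p (f x)) a) \<le> e / 2"
      using p(2) by (intro rcf_norm_upper[OF sa] continuous_on_diff gf cont' p(1)) (auto simp: less_imp_le)
    moreover have "rcf g ?b - rcf (\<lambda>x. g (f x)) a
      = rcf (\<lambda>x. g x - p x) ?b - rcf (\<lambda>x. g (f x) - p (f x)) a"
      using peq[OF p(1)] by (simp add: rcf_diff[OF sa gf cont'[OF p(1)]] rcf_diff[OF sb gb cont[OF p(1)]])
    ultimately show ?thesis
      using norm_triangle_ineq4[of "rcf (\<lambda>x. g x - p x) ?b" "rcf (\<lambda>x. g (f x) - p (f x)) a"] by simp
  qed
  have "norm (rcf g ?b - rcf (\<lambda>x. g (f x)) a) \<le> 0"
    by (rule field_le_epsilon) (use norm0 in simp)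
  then show ?thesis by simp
qed

text \<open>Turns a spectral interval into a norm ball around its midpoint, so that the triangle
  inequality controls the spectrum of a sum of elements that need not commute.\<close>

lemma rspec_dist_le_iff:
  assumes sa: "star a = a"
  shows "(\<forall>x\<in>rspec a. \<bar>s - x\<bar> \<le> r) \<longleftrightarrow> norm (s *\<^sub>R 1 - a) \<le> r"
proof -
  have c: "continuous_on (rspec a) (\<lambda>x. s - x)" by (intro continuous_intros)
  have "rcf (\<lambda>x. s - x) a = s *\<^sub>R 1 - a"
    using rcf_diff[OF sa, of "\<lambda>_. s" "\<lambda>x. x"] by (simp add: rcf_const[OF sa] rcf_ident[OF sa])
  then show ?thesis using rcf_norm_upper[OF sa c] rcf_norm_lower[OF sa c] by (metis order_trans)
qed

lemma rspec_scaleR: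
  assumes "star a = a"
  shows "rspec (r *\<^sub>R a) = (\<lambda>x. r * x) ` rspec a"
  using rspec_rcf[OF assms, of "\<lambda>x. r * x"] rcf_scaleR[OF assms, of "\<lambda>x. x" r] rcf_ident[OF assms]
  by (simp add: continuous_intros)

section \<open>Positive invertible elements\<close>

lemma pos_invertibles_iff: "a \<in> pos_invertibles \<longleftrightarrow> star a = a \<and> (\<forall>x\<in>rspec a. x > 0)"
proof (cases "star a = a")
  case True
  have "invertible_elem a \<longleftrightarrow> 0 \<notin> rspec a"
    using rspec_iff[OF True, of 0] invertible_elem_scaleC_iff[of "- 1" a] by (simp add: scaleC_one)
  moreover have "spectrum a \<subseteq> \<real>\<^sub>\<ge>\<^sub>0 \<longleftrightarrow> (\<forall>x\<in>rspec a. x \<ge> 0)"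
    unfolding spectrum_eq_rspec[OF True] by auto
  ultimately show ?thesis
    using True unfolding pos_invertibles_def positive_elem_def by (auto simp: less_le)
qed (simp add: pos_invertibles_def positive_elem_def)

lemma pos_invertiblesD:
  assumes "a \<in> pos_invertibles"
  shows "star a = a" "\<And>x. x \<in> rspec a \<Longrightarrow> x > 0"
  using assms by (auto simp: pos_invertibles_iff)

lemma pos_invertibles_bounds:
  assumes a: "a \<in> pos_invertibles"
  obtains l h where "0 < l" "l \<le> h" "rspec a \<subseteq> {l..h}"
proof -
  note sa = pos_invertiblesD(1)[OF a]
  obtain l where l: "l \<in> rspec a" "\<And>x. x \<in> rspec a \<Longrightarrow> l \<le> x"
    using compact_attains_inf[OF compact_rspec rspec_nonempty[OF sa]] by auto
  obtain h where h: "h \<in> rspec a" "\<And>x. x \<in> rspec a \<Longrightarrow> x \<le> h"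
    using compact_attains_sup[OF compact_rspec rspec_nonempty[OF sa]] by auto
  show thesis using that[of l h] l h pos_invertiblesD(2)[OF a] by force
qed

lemma pos_invertibles_add:
  assumes a: "a \<in> pos_invertibles" and b: "b \<in> pos_invertibles"
  shows "a + b \<in> pos_invertibles"
proof -
  note sa = pos_invertiblesD(1)[OF a] and sb = pos_invertiblesD(1)[OF b]
  obtain l h where l: "0 < l" "rspec a \<subseteq> {l..h}" using pos_invertibles_bounds[OF a] by metis
  obtain l' h' where l': "0 < l'" "rspec b \<subseteq> {l'..h'}" using pos_invertibles_bounds[OF b] by metis
  have "norm (((l + h) / 2) *\<^sub>R 1 - a) \<le> (h - l) / 2" "norm (((l' + h') / 2) *\<^sub>R 1 - b) \<le> (h' - l') / 2"
    unfolding rspec_dist_le_iff[OF sa, symmetric] rspec_dist_le_iff[OF sb, symmetric]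
    using l l' by (auto simp: abs_if subset_iff field_simps)
  moreover have "((l + h) / 2 + (l' + h') / 2) *\<^sub>R 1 - (a + b)
    = (((l + h) / 2) *\<^sub>R 1 - a) + (((l' + h') / 2) *\<^sub>R 1 - b)"
    by (simp add: scaleR_add_left)
  ultimately have "norm (((l + h) / 2 + (l' + h') / 2) *\<^sub>R 1 - (a + b)) \<le> (h - l) / 2 + (h' - l') / 2"
    by (metis norm_triangle_mono)
  moreover have sab: "star (a + b) = a + b" by (simp add: star_add sa sb)
  ultimately have "\<bar>(l + h) / 2 + (l' + h') / 2 - x\<bar> \<le> (h - l) / 2 + (h' - l') / 2" if "x \<in> rspec (a + b)" for x
    using that rspec_dist_le_iff[OF sab] by blast
  then have "x > 0" if "x \<in> rspec (a + b)" for x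
    using that l(1) l'(1) by (force simp: abs_le_iff field_simps)
  then show ?thesis using sab by (simp add: pos_invertibles_iff)
qed

lemma pos_invertibles_scaleR:
  assumes "a \<in> pos_invertibles" "r > 0"
  shows "r *\<^sub>R a \<in> pos_invertibles"
  using assms by (auto simp: pos_invertibles_iff rspec_scaleR star_scaleR)

lemma rcf_pos_invertibles:
  assumes "star a = a" "continuous_on (rspec a) f" "\<And>x. x \<in> rspec a \<Longrightarrow> f x > 0"
  shows "rcf f a \<in> pos_invertibles"
  using assms by (auto simp: pos_invertibles_iff rspec_rcf star_rcf)

lemma is_inverse_rcf_inverse:
  assumes "b \<in> pos_invertibles"
  shows "is_inverse b (rcf inverse b)"
  using rcf_is_inverse[OF pos_invertiblesD(1)[OF assms], of "\<lambda>x. x"] pos_invertiblesD(2)[OF assms]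
  by (force simp: rcf_ident[OF pos_invertiblesD(1)[OF assms]] intro: continuous_intros)

lemma log_elem_eq_rcf:
  assumes "a \<in> pos_invertibles"
  shows "log_elem a = rcf ln a"
  unfolding log_elem_def rcf_def
proof (rule cfc_cong)
  note sa = pos_invertiblesD(1)[OF assms]
  show "star a = a" by (rule sa)
  have real: "z = of_real (Re z)" "Re z > 0" if "z \<in> spectrum a" for z
    using that pos_invertiblesD(2)[OF assms] spectrum_selfadjoint_real[OF sa that]
    by (auto simp: rspec_def complex_eq_iff)
  have "z \<notin> \<real>\<^sub>\<le>\<^sub>0" if "z \<in> spectrum a" for z
    using real(2)[OF that] by (auto elim: nonpos_Reals_cases)
  then show "continuous_on (spectrum a) Ln" by (intro continuous_on_Ln continuous_intros) auto
  show "Ln z = complex_of_real (ln (Re z))" if "z \<in> spectrum a" for z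
    using real[OF that] by (metis Ln_of_real)
qed

section \<open>The trace and Klein's inequality\<close>

context faithful_tracial_state
begin

definition tr :: "'a \<Rightarrow> real" where
  "tr x = Re (\<tau> x)"

lemma tr_add: "tr (x + y) = tr x + tr y"
  by (simp add: tr_def add)

lemma tr_scaleR: "tr (r *\<^sub>R x) = r * tr x"
  by (simp add: tr_def scaleR_scaleC scaleC)

lemma tr_zero: "tr 0 = 0"
  using tr_scaleR[of 0 0] by simp

lemma tr_minus: "tr (- x) = - tr x"
  using tr_scaleR[of "- 1" x] by simp

lemma tr_diff: "tr (x - y) = tr x - tr y"
  using tr_add[of x "- y"] by (simp add: tr_minus)

lemma tr_one: "tr 1 = 1"
  by (simp add: tr_def unital)

lemma tr_mult_commute: "tr (x * y) = tr (y * x)"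
  by (simp add: tr_def tracial[of x])

lemma tr_star_mult_self_nonneg: "0 \<le> tr (star x * x)"
  using positive[of x] by (auto simp: tr_def complex_nonneg_Reals_iff)

lemma tr_star_mult_self_eq_0: "tr (star x * x) = 0 \<Longrightarrow> x = 0"
  using positive[of x] by (intro faithful) (auto simp: tr_def complex_nonneg_Reals_iff complex_eq_iff)

text \<open>Expanding \<open>star (1 + x) * (1 + x)\<close> leaves twice the value at
  \<open>x\<close> plus values already known to be real.\<close>

lemma tau_selfadjoint_real:
  assumes sa: "star x = x"
  shows "Im (\<tau> x) = 0"
proof -
  have pos: "Im (\<tau> (star y * y)) = 0" for y
    using positive[of y] by (auto simp: complex_nonneg_Reals_iff)
  have "star (1 + x) * (1 + x) = 1 + x + (x + star x * x)" by (simp add: star_add sa algebra_simps)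
  then have "\<tau> (star (1 + x) * (1 + x)) = 1 + \<tau> x + (\<tau> x + \<tau> (star x * x))" by (simp add: add unital)
  then have "Im (1 + \<tau> x + (\<tau> x + \<tau> (star x * x))) = 0" using pos[of "1 + x"] by simp
  then show ?thesis using pos[of x] by simp
qed

text \<open>The element \<open>\<i> *\<^sub>C (x - star x)\<close> is self-adjoint, and the
  imaginary part of its trace is \<open>tr x - tr (star x)\<close>.\<close>

lemma tr_star: "tr (star x) = tr x"
proof -
  have "star (\<i> *\<^sub>C (x - star x)) = \<i> *\<^sub>C (x - star x)"
    by (simp add: star_scaleC star_diff star_star scaleC_diff_right)
  then have "Im (\<tau> (\<i> *\<^sub>C (x - star x))) = 0" by (rule tau_selfadjoint_real)
  then show ?thesis using tr_diff[of x "star x"] by (simp add: scaleC tr_def)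
qed

lemma tr_rcf_lincomb:
  assumes sa: "star a = a" and f: "continuous_on (rspec a) f" and g: "continuous_on (rspec a) g"
  shows "tr (rcf (\<lambda>x. c * f x + d * g x) a) = c * tr (rcf f a) + d * tr (rcf g a)"
  using f g by (simp add: rcf_add[OF sa] rcf_scaleR[OF sa] continuous_on_mult tr_add tr_scaleR)

lemma tr_rcf_nonneg:
  assumes sa: "star a = a" and f: "continuous_on (rspec a) f" and nn: "\<And>x. x \<in> rspec a \<Longrightarrow> 0 \<le> f x"
  shows "0 \<le> tr (rcf f a)"
proof -
  have s: "continuous_on (rspec a) (\<lambda>x. sqrt (f x))" by (intro continuous_intros f)
  have "rcf f a = star (rcf (\<lambda>x. sqrt (f x)) a) * rcf (\<lambda>x. sqrt (f x)) a"
    unfolding star_rcf[OF sa s] rcf_mult[OF sa s s, symmetric]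
    by (rule rcf_cong[OF sa f]) (simp add: nn)
  then show ?thesis using tr_star_mult_self_nonneg by simp
qed

text \<open>With square roots \<open>s\<close> of the first and \<open>r\<close> of the second
  factor, cyclicity turns the trace of \<open>s * s * r * r\<close> into that of
  \<open>star (r * s) * (r * s)\<close>. The product itself need not even be self-adjoint; the
  comparisons under the trace between elements that do not commute rest on this.\<close>

lemma tr_mult_rcf_nonneg:
  assumes sa: "star a = a" and f: "continuous_on (rspec a) f" and fn: "\<And>x. x \<in> rspec a \<Longrightarrow> 0 \<le> f x"
    and sb: "star b = b" and g: "continuous_on (rspec b) g" and gn: "\<And>x. x \<in> rspec b \<Longrightarrow> 0 \<le> g x"
  shows "0 \<le> tr (rcf f a * rcf g b)"
proof -
  let ?s = "rcf (\<lambda>x. sqrt (f x)) a" and ?r = "rcf (\<lambda>x. sqrt (g x)) b"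
  have s: "continuous_on (rspec a) (\<lambda>x. sqrt (f x))" by (intro continuous_intros f)
  have r: "continuous_on (rspec b) (\<lambda>x. sqrt (g x))" by (intro continuous_intros g)
  have "rcf f a = ?s * ?s"
    unfolding rcf_mult[OF sa s s, symmetric] by (rule rcf_cong[OF sa f]) (simp add: fn)
  moreover have "rcf g b = ?r * ?r"
    unfolding rcf_mult[OF sb r r, symmetric] by (rule rcf_cong[OF sb g]) (simp add: gn)
  ultimately have "tr (rcf f a * rcf g b) = tr (?s * (?s * ?r * ?r))" by (simp add: mult.assoc)
  also have "\<dots> = tr (?s * ?r * (?r * ?s))" by (subst tr_mult_commute) (simp add: mult.assoc)
  also have "\<dots> = tr (star (?r * ?s) * (?r * ?s))"
    by (simp add: star_mult star_rcf[OF sa s] star_rcf[OF sb r])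
  finally show ?thesis using tr_star_mult_self_nonneg by simp
qed

lemma tr_mult_rcf_mono:
  assumes sa: "star a = a" and f: "continuous_on (rspec a) f" and fn: "\<And>x. x \<in> rspec a \<Longrightarrow> 0 \<le> f x"
    and sb: "star b = b" and g: "continuous_on (rspec b) g" and h: "continuous_on (rspec b) h"
    and le: "\<And>x. x \<in> rspec b \<Longrightarrow> g x \<le> h x"
  shows "tr (rcf f a * rcf g b) \<le> tr (rcf f a * rcf h b)"
  using tr_mult_rcf_nonneg[OF sa f fn sb, of "\<lambda>x. h x - g x"] g h le
  by (simp add: continuous_on_diff rcf_diff[OF sb] right_diff_distrib tr_diff)

lemma tr_rcf_mono:
  assumes sa: "star a = a" and f: "continuous_on (rspec a) f" and g: "continuous_on (rspec a) g"
    and le: "\<And>x. x \<in> rspec a \<Longrightarrow> f x \<le> g x"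
  shows "tr (rcf f a) \<le> tr (rcf g a)"
  using tr_rcf_nonneg[OF sa, of "\<lambda>x. g x - f x"] f g le
  by (simp add: continuous_on_diff rcf_diff[OF sa] tr_diff)

text \<open>For self-adjoint \<open>y\<close> the spectrum lies between \<open>- norm y\<close> and
  \<open>norm y\<close>; a general \<open>x\<close> has the same \<open>tr\<close> as its
  self-adjoint part. Continuity of \<open>tr\<close> follows, as the limit arguments
  require.\<close>

lemma abs_tr_le_norm: "\<bar>tr x\<bar> \<le> norm x"
proof -
  have sa_case: "\<bar>tr y\<bar> \<le> norm y" if sa: "star y = y" for y
  proof -
    have "\<bar>0 - u\<bar> \<le> norm y" if "u \<in> rspec y" for u
      using that rspec_dist_le_iff[OF sa, of 0 "norm y"] by auto
    then have b: "- norm y \<le> u" "u \<le> norm y" if "u \<in> rspec y" for u using that by (force simp: abs_le_iff)+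
    have "tr (rcf (\<lambda>u. - norm y) y) \<le> tr (rcf (\<lambda>u. u) y)" "tr (rcf (\<lambda>u. u) y) \<le> tr (rcf (\<lambda>u. norm y) y)"
      by (intro tr_rcf_mono sa continuous_intros b; assumption)+
    then show ?thesis by (simp add: rcf_const[OF sa] rcf_ident[OF sa] tr_scaleR tr_one tr_minus)
  qed
  have "tr x = tr ((1/2) *\<^sub>R (x + star x))" by (simp add: tr_scaleR tr_add tr_star)
  also have "\<bar>\<dots>\<bar> \<le> norm ((1/2) *\<^sub>R (x + star x))"
    by (rule sa_case) (simp add: star_scaleR star_add star_star add.commute)
  also have "\<dots> \<le> norm x" using norm_triangle_ineq[of x "star x"] by simp
  finally show ?thesis .
qed

lemma bounded_linear_tr: "bounded_linear tr"
  by (rule bounded_linear_intro[where K = 1]) (simp_all add: tr_add tr_scaleR abs_tr_le_norm)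

text \<open>The trace replaces the usual detour through the spectra of \<open>x\<^sup>* x\<close> and \<open>x x\<^sup>*\<close>: with \<open>b = x\<^sup>* x\<close>
  and negative part \<open>n\<close>, the trace of \<open>n b n = - n\<^sup>3\<close> is nonnegative, so faithfulness gives \<open>n = 0\<close>.\<close>

lemma rspec_star_mult_self_nonneg:
  fixes x :: 'a
  assumes "u \<in> rspec (star x * x)"
  shows "0 \<le> u"
proof -
  define b where "b = star x * x"
  have sb: "star b = b" by (simp add: b_def star_mult star_star)
  define n where "n = (\<lambda>v::real. max 0 (- v))"
  define s where "s = (\<lambda>v. sqrt (n v ^ 3))"
  have cn: "continuous_on S n" for S unfolding n_def by (intro continuous_intros)
  have cs: "continuous_on S s" for S unfolding s_def by (intro continuous_intros cn)
  let ?n = "rcf n b" and ?s = "rcf s b"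
  have n0: "0 \<le> n v" for v by (simp add: n_def)
  have "?n * b * ?n = rcf (\<lambda>v. n v * v * n v) b"
    by (simp add: rcf_mult[OF sb] cn continuous_on_mult continuous_on_id rcf_ident[OF sb])
  also have "\<dots> = rcf (\<lambda>v. - (s v * s v)) b"
    by (intro rcf_cong[OF sb] continuous_intros cn)
      (auto simp: s_def n0 n_def max_def power3_eq_cube)
  also have "\<dots> = - (star ?s * ?s)"
    by (simp add: rcf_minus[OF sb] rcf_mult[OF sb] cs continuous_on_mult star_rcf[OF sb])
  finally have "?n * b * ?n = - (star ?s * ?s)" .
  moreover have "?n * b * ?n = star (x * ?n) * (x * ?n)"
    by (simp add: b_def star_mult mult.assoc) (simp flip: b_def add: star_rcf[OF sb] cn)
  ultimately have "tr (star ?s * ?s) \<le> 0"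
    using tr_star_mult_self_nonneg[of "x * ?n"] by (simp add: tr_minus)
  then have "?s = 0" using tr_star_mult_self_nonneg[of ?s] by (intro tr_star_mult_self_eq_0) simp
  then have "s u = 0" using rcf_norm_lower[OF sb cs, of u] assms by (simp add: b_def)
  then show ?thesis by (auto simp: s_def n_def max_def split: if_splits)
qed

text \<open>With a square root \<open>s\<close> of \<open>z\<close> the congruence is
  \<open>star (s * x) * (s * x)\<close>, which has nonnegative spectrum; invertibility excludes
  \<open>0\<close>.\<close>

lemma pos_invertibles_congruence:
  fixes x z :: 'a
  assumes x: "star x = x" "invertible_elem x" and z: "z \<in> pos_invertibles"
  shows "x * z * x \<in> pos_invertibles"
proof -
  note sz = pos_invertiblesD(1)[OF z]
  let ?s = "rcf sqrt z"
  have cs: "continuous_on S sqrt" for S by (intro continuous_intros)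
  have "?s * ?s = rcf (\<lambda>x. x) z"
    unfolding rcf_mult[OF sz cs cs, symmetric]
    by (rule rcf_cong[OF sz]) (auto intro!: continuous_intros dest!: pos_invertiblesD(2)[OF z])
  then have "x * z * x = star (?s * x) * (?s * x)"
    using x(1) by (simp add: star_mult star_rcf[OF sz cs] rcf_ident[OF sz] mult.assoc)
      (simp flip: mult.assoc)
  then have nn: "u \<ge> 0" if "u \<in> rspec (x * z * x)" for u
    using that rspec_star_mult_self_nonneg by metis
  have sa: "star (x * z * x) = x * z * x" by (simp add: star_mult x(1) sz mult.assoc)
  have "invertible_elem (x * z * x)" using x(2) z by (simp add: invertible_elem_mult pos_invertibles_def)
  then have "0 \<notin> rspec (x * z * x)"
    using rspec_iff[OF sa, of 0] invertible_elem_scaleC_iff[of "- 1" "x * z * x"] by (simp add: scaleC_one)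
  then show ?thesis using sa nn by (force simp: pos_invertibles_iff less_le)
qed

section \<open>The trace of the logarithm\<close>

definition trln :: "'a \<Rightarrow> real" where
  "trln a = tr (rcf ln a)"

lemma trln_rcf:
  assumes sa: "star a = a" and f: "continuous_on (rspec a) f" and p: "\<And>x. x \<in> rspec a \<Longrightarrow> f x > 0"
  shows "trln (rcf f a) = tr (rcf (\<lambda>x. ln (f x)) a)"
  unfolding trln_def
  by (subst rcf_comp[OF sa f]) (auto intro!: continuous_intros dest!: p)

lemma continuous_on_ln_rspec: "a \<in> pos_invertibles \<Longrightarrow> continuous_on (rspec a) ln"
  by (intro continuous_intros) (auto dest: pos_invertiblesD(2))

text \<open>The Bernstein polynomials of \<open>b\<close> are a positive partition of unity concentrated near the
  nodes \<open>y\<close>, on which the hypothesis for \<open>n = y\<close> is applied.\<close>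

lemma tr_le_of_tangent_bounds:
  assumes b: "b \<in> pos_invertibles"
    and bound: "\<And>n f. \<lbrakk>n > 0; continuous_on (rspec b) f; \<And>x. x \<in> rspec b \<Longrightarrow> 0 \<le> f x\<rbrakk>
      \<Longrightarrow> tr (rcf f b * x) \<le> tr (rcf f b * (inverse n *\<^sub>R m + (ln n - 1) *\<^sub>R 1))"
  shows "tr x \<le> tr (rcf inverse b * m) + trln b - 1"
proof -
  note sb = pos_invertiblesD(1)[OF b]
  obtain l h where lh: "0 < l" "rspec b \<subseteq> {l..h}" using pos_invertibles_bounds[OF b] by metis
  \<comment> \<open>The \<open>+ 1\<close> keeps \<open>w\<close> positive when the spectrum is a
    single point. The nodes \<open>y N k\<close> may lie outside the spectrum, and
    \<open>bound\<close> covers every \<open>n > 0\<close>; for \<open>N = 0\<close> division by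
    zero gives the node \<open>l\<close>.\<close>
  define w where "w = h - l + 1"
  have "l \<le> h" using rspec_nonempty[OF sb] lh(2) by fastforce
  then have w: "w > 0" by (simp add: w_def)
  define B where "B N k u = Bernstein N k ((u - l) / w)" for N k u
  define y where "y N k = l + w * (real k / real N)" for N k
  define G where "G f N u = (\<Sum>k\<le>N. f (y N k) * B N k u)" for f N u
  have unit: "(u - l) / w \<in> {0..1}" if "u \<in> rspec b" for u
    using that lh w by (auto simp: w_def field_simps subset_iff)
  have Bnn: "0 \<le> B N k u" if "u \<in> rspec b" for N k u
    unfolding B_def using unit[OF that] by (auto intro: Bernstein_nonneg)
  have Bc: "continuous_on S (B N k)" for S N k
    unfolding B_def Bernstein_def using w by (intro continuous_intros) auto
  have Bsum: "(\<Sum>k\<le>N. rcf (B N k) b) = 1" for N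
    using rcf_sum[OF sb, of "{..N}" "B N"] Bc by (simp add: B_def sum_Bernstein rcf_one[OF sb])
  have ypos: "y N k > 0" for N k using lh(1) w by (simp add: y_def add_pos_nonneg)
  have Glim: "(\<lambda>N. rcf (G f N) b) \<longlonglongrightarrow> rcf f b" if f: "continuous_on {0<..} f" for f
  proof (rule LIMSEQ_I)
    fix e :: real assume e: "e > 0"
    have "continuous_on {0..1} (\<lambda>s. f (l + w * s))"
      by (rule continuous_on_compose2[OF f]) (use lh w in \<open>auto intro!: continuous_intros add_pos_nonneg\<close>)
    then obtain M where M: "\<And>N s. N \<ge> M \<Longrightarrow> s \<in> {0..1} \<Longrightarrow>
        \<bar>f (l + w * s) - (\<Sum>k\<le>N. f (l + w * (real k / real N)) * Bernstein N k s)\<bar> < e / 2"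
      using Bernstein_Weierstrass[of "\<lambda>s. f (l + w * s)" "e / 2"] e by auto
    show "\<exists>M. \<forall>N\<ge>M. norm (rcf (G f N) b - rcf f b) < e"
    proof (intro exI allI impI)
      fix N assume N: "N \<ge> M"
      have cf: "continuous_on (rspec b) f"
        by (rule continuous_on_subset[OF f]) (auto dest: pos_invertiblesD(2)[OF b])
      have cG: "continuous_on (rspec b) (G f N)"
        unfolding G_def by (intro continuous_intros Bc)
      have "norm (rcf (\<lambda>u. G f N u - f u) b) \<le> e / 2"
      proof (rule rcf_norm_upper[OF sb continuous_on_diff[OF cG cf]])
        fix u assume "u \<in> rspec b"
        from M[OF N unit[OF this]] w show "\<bar>G f N u - f u\<bar> \<le> e / 2"
          by (simp add: G_def B_def y_def abs_minus_commute)
      qed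
      then show "norm (rcf (G f N) b - rcf f b) < e" using e by (simp add: rcf_diff[OF sb cG cf])
    qed
  qed
  have Geq: "rcf (G f N) b = (\<Sum>k\<le>N. f (y N k) *\<^sub>R rcf (B N k) b)" for f N
    unfolding G_def by (simp add: rcf_sum[OF sb] rcf_scaleR[OF sb] Bc continuous_on_mult)
  \<comment> \<open>Summed over \<open>k\<close>, the node values \<open>inverse (y N k)\<close> and
    \<open>ln (y N k)\<close> become the Bernstein approximants of \<open>inverse\<close> and
    \<open>ln\<close>; the constant \<open>- 1\<close> stays because the weights add up to
    \<open>1\<close>.\<close>
  have step: "tr x \<le> tr (rcf (G inverse N) b * m) + (tr (rcf (G ln N) b) - 1)" for N
  proof -
    interpret tr: bounded_linear tr by (rule bounded_linear_tr)
    have "tr x = tr ((\<Sum>k\<le>N. rcf (B N k) b) * x)" by (simp add: Bsum)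
    also have "\<dots> = (\<Sum>k\<le>N. tr (rcf (B N k) b * x))" by (simp add: sum_distrib_right tr.sum)
    also have "\<dots> \<le> (\<Sum>k\<le>N. tr (rcf (B N k) b * (inverse (y N k) *\<^sub>R m + (ln (y N k) - 1) *\<^sub>R 1)))"
      by (intro sum_mono bound ypos Bc Bnn)
    also have "\<dots> = (\<Sum>k\<le>N. inverse (y N k) * tr (rcf (B N k) b * m) + (ln (y N k) * tr (rcf (B N k) b) - tr (rcf (B N k) b)))"
      by (simp add: distrib_left tr_add tr_scaleR left_diff_distrib)
    also have "\<dots> = (\<Sum>k\<le>N. inverse (y N k) * tr (rcf (B N k) b * m))
        + ((\<Sum>k\<le>N. ln (y N k) * tr (rcf (B N k) b)) - tr (\<Sum>k\<le>N. rcf (B N k) b))"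
      by (simp add: sum.distrib sum_subtractf tr.sum)
    also have "\<dots> = tr (rcf (G inverse N) b * m) + (tr (rcf (G ln N) b) - 1)"
      by (simp add: Bsum tr_one) (simp add: Geq sum_distrib_right tr.sum tr_scaleR)
    finally show ?thesis .
  qed
  have "(\<lambda>N. tr (rcf (G inverse N) b * m) + (tr (rcf (G ln N) b) - 1))
      \<longlonglongrightarrow> tr (rcf inverse b * m) + (tr (rcf ln b) - 1)"
    by (intro tendsto_intros bounded_linear.tendsto[OF bounded_linear_tr] Glim)
      (auto intro!: continuous_intros)
  then show ?thesis
    using LIMSEQ_le_const[of _ _ "tr x"] step by (fastforce simp: trln_def)
qed

lemma ln_le_tangent: "(u::real) > 0 \<Longrightarrow> n > 0 \<Longrightarrow> ln u \<le> inverse n * u + (ln n - 1)"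
  using ln_le_minus_one[of "u / n"] by (simp add: ln_div field_simps)

text \<open>The tangent of \<open>ln\<close> at a scalar \<open>n\<close> bounds \<open>ln a\<close>
  within the calculus of \<open>a\<close>. Under the trace, letting \<open>n\<close> follow the
  spectrum of \<open>b\<close> replaces \<open>inverse n\<close> by the inverse of \<open>b\<close>
  and \<open>ln n\<close> by \<open>ln b\<close>.\<close>

lemma klein_ln:
  assumes a: "a \<in> pos_invertibles" and b: "b \<in> pos_invertibles" and c: "is_inverse b c"
  shows "trln a \<le> trln b + tr (c * a) - 1"
proof -
  note sa = pos_invertiblesD(1)[OF a] and sb = pos_invertiblesD(1)[OF b]

  have "tr (rcf ln a) \<le> tr (rcf inverse b * a) + trln b - 1"
  proof (rule tr_le_of_tangent_bounds[OF b])
    fix n :: real and f :: "real \<Rightarrow> real"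
    assume n: "n > 0" and f: "continuous_on (rspec b) f" "\<And>x. x \<in> rspec b \<Longrightarrow> 0 \<le> f x"
    have "tr (rcf f b * rcf ln a) \<le> tr (rcf f b * rcf (\<lambda>u. inverse n * u + (ln n - 1)) a)"
      using ln_le_tangent n pos_invertiblesD(2)[OF a]
      by (intro tr_mult_rcf_mono sa sb f continuous_on_ln_rspec[OF a] continuous_intros) auto
    also have "rcf (\<lambda>u. inverse n * u + (ln n - 1)) a = inverse n *\<^sub>R a + (ln n - 1) *\<^sub>R 1"
      by (rule rcf_affine[OF sa])
    finally show "tr (rcf f b * rcf ln a) \<le> tr (rcf f b * (inverse n *\<^sub>R a + (ln n - 1) *\<^sub>R 1))" .
  qed
  then show ?thesis using is_inverse_unique[OF is_inverse_rcf_inverse[OF b] c] by (simp add: trln_def)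
qed

end

section \<open>Congruence invariance of the trace of the logarithm\<close>

text \<open>This and the next lemma bound the remainders of \<open>exp\<close> of first and second
  order, with a factor that stays bounded on a compact spectrum. Both come from the tangent of
  \<open>exp\<close> at \<open>0\<close>.\<close>

lemma abs_exp_minus_one_le: "\<bar>exp v - 1\<bar> \<le> \<bar>v\<bar> * exp \<bar>v::real\<bar>"
proof (cases "v \<ge> 0")
  case True
  have "exp v * (1 - v) \<le> exp v * exp (- v)"
    using exp_ge_add_one_self[of "- v"] by (intro mult_left_mono) auto
  then show ?thesis using True by (simp add: algebra_simps flip: exp_add)
next
  case False
  have "exp v < 1" using False by simp
  then have "\<bar>exp v - 1\<bar> \<le> \<bar>v\<bar> * 1" using exp_ge_add_one_self[of v] by linarith
  also have "\<dots> \<le> \<bar>v\<bar> * exp \<bar>v\<bar>" by (intro mult_left_mono) auto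
  finally show ?thesis .
qed

lemma exp_minus_one_minus_le: "exp v - 1 - v \<le> v\<^sup>2 * exp \<bar>v::real\<bar>"
proof -
  have "exp v * (1 - v) \<le> exp v * exp (- v)"
    using exp_ge_add_one_self[of "- v"] by (intro mult_left_mono) auto
  then have "exp v - 1 - v \<le> v * (exp v - 1)" by (simp add: algebra_simps flip: exp_add)
  also have "\<dots> \<le> \<bar>v\<bar> * \<bar>exp v - 1\<bar>" by (metis abs_ge_self abs_mult)
  also have "\<dots> \<le> \<bar>v\<bar> * (\<bar>v\<bar> * exp \<bar>v\<bar>)" by (intro mult_left_mono abs_exp_minus_one_le) auto
  finally show ?thesis by (simp add: power2_eq_square flip: mult.assoc)
qed

context faithful_tracial_state
begin

text \<open>Write \<open>x = v\<^bsup>n\<^esup>\<close>. Klein's inequality gives \<open>trln (v z v) \<le> trln z + 2 tr (v - 1) + O(n\<^bsup>-2\<^esup>)\<close>, and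
  \<open>n tr (v - 1)\<close> tends to \<open>trln x\<close>.\<close>

lemma trln_congruence_le:
  assumes x: "x \<in> pos_invertibles" and y: "y \<in> pos_invertibles"
  shows "trln (x * y * x) \<le> trln y + 2 * trln x"
proof -
  note sx = pos_invertiblesD(1)[OF x] and sy = pos_invertiblesD(1)[OF y]
  obtain l h where lh: "0 < l" "l \<le> h" "rspec x \<subseteq> {l..h}" using pos_invertibles_bounds[OF x] by metis
  define q where "q = \<bar>ln l\<bar> + \<bar>ln h\<bar>"
  have q: "\<bar>ln u\<bar> \<le> q" if "u \<in> rspec x" for u
  proof -
    have "ln l \<le> ln u" "ln u \<le> ln h" using that lh by (auto simp: subset_iff)
    then show ?thesis unfolding q_def by linarith
  qed
  have q0: "q \<ge> 0" by (simp add: q_def)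
  \<comment> \<open>The real powers of \<open>x\<close>; as a one-parameter group they supply the
    \<open>n\<close>-th root \<open>V (1 / n)\<close> and its inverse.\<close>
  define V where "V s = rcf (\<lambda>u. exp (s * ln u)) x" for s
  note cl = continuous_on_ln_rspec[OF x]
  have cV: "continuous_on (rspec x) (\<lambda>u. exp (s * ln u))" for s by (intro continuous_intros cl)
  have V_add: "V s * V t = V (s + t)" for s t
    unfolding V_def rcf_mult[OF sx cV cV, symmetric] by (simp add: exp_add distrib_right)
  have V0: "V 0 = 1" by (simp add: V_def rcf_one[OF sx])
  have V1: "V 1 = x"
  proof -
    have "V 1 = rcf (\<lambda>u. u) x" unfolding V_def
      by (rule rcf_cong[OF sx cV]) (simp add: pos_invertiblesD(2)[OF x])
    then show ?thesis by (simp add: rcf_ident[OF sx])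
  qed
  have sV: "star (V s) = V s" for s unfolding V_def by (rule star_rcf[OF sx cV])
  have V_inv: "is_inverse (V s) (V (- s))" for s by (simp add: is_inverse_def V_add V0)
  have V_norm: "norm (V s) \<le> exp q" if "\<bar>s\<bar> \<le> 1" for s
    unfolding V_def
  proof (rule rcf_norm_upper[OF sx cV])
    fix u assume "u \<in> rspec x"
    then have "\<bar>s * ln u\<bar> \<le> 1 * q" unfolding abs_mult using that q by (intro mult_mono) auto
    then show "\<bar>exp (s * ln u)\<bar> \<le> exp q" by simp
  qed
  define yi where "yi = rcf inverse y"
  have yi: "is_inverse y yi" unfolding yi_def by (rule is_inverse_rcf_inverse[OF y])
  \<comment> \<open>Bounds \<open>norm (W k) * norm (Z k)\<close>, with \<open>W\<close> and
    \<open>Z\<close> as below, for all \<open>k < n\<close> and all \<open>n\<close> at once, since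
    the exponents stay between \<open>- 1\<close> and \<open>1\<close>.\<close>
  define C where "C = (exp q * norm yi * exp q) * (exp q * norm y * exp q)"
  have C0: "C \<ge> 0" by (simp add: C_def)
  \<comment> \<open>The first summand is the second-order error of the two occurrences of
    \<open>tr d\<close>; the second comes from the term with two factors \<open>d\<close>.\<close>
  define K where "K = 2 * (q\<^sup>2 * exp q) + C * (q * exp q)\<^sup>2"
  have main: "trln (x * y * x) \<le> trln y + 2 * trln x + K / n" if n: "n > 0" for n :: nat
  proof -
    define e where "e = 1 / real n"
    have e: "e > 0" "e \<le> 1" "real n * e = 1" using n by (simp_all add: e_def)
    define d where "d = V e - 1"
    have d: "d = rcf (\<lambda>u. exp (e * ln u) - 1) x"
      by (simp add: d_def V_def rcf_diff[OF sx cV] rcf_one[OF sx])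
    have small: "\<bar>e * ln u\<bar> \<le> e * q" "exp \<bar>e * ln u\<bar> \<le> exp q" if "u \<in> rspec x" for u
    proof -
      show 1: "\<bar>e * ln u\<bar> \<le> e * q" using q[OF that] e by (simp add: abs_mult)
      have "e * q \<le> 1 * q" using e q0 by (intro mult_right_mono) auto
      then show "exp \<bar>e * ln u\<bar> \<le> exp q" using 1 by simp
    qed
    have d_norm: "norm d \<le> e * q * exp q"
      unfolding d
    proof (rule rcf_norm_upper[OF sx])
      fix u assume u: "u \<in> rspec x"
      have "\<bar>exp (e * ln u) - 1\<bar> \<le> \<bar>e * ln u\<bar> * exp \<bar>e * ln u\<bar>" by (rule abs_exp_minus_one_le)
      also have "\<dots> \<le> e * q * exp q" using small[OF u] e q0 by (intro mult_mono) auto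
      finally show "\<bar>exp (e * ln u) - 1\<bar> \<le> e * q * exp q" .
    qed (intro continuous_intros cl)
    have "tr d \<le> tr (rcf (\<lambda>u. e * ln u + e\<^sup>2 * (q\<^sup>2 * exp q)) x)"
      unfolding d
    proof (rule tr_rcf_mono[OF sx])
      fix u assume u: "u \<in> rspec x"
      have "(e * ln u)\<^sup>2 \<le> (e * q)\<^sup>2" using small(1)[OF u] by (metis abs_ge_zero power2_abs power_mono)
      then have "(e * ln u)\<^sup>2 * exp \<bar>e * ln u\<bar> \<le> (e * q)\<^sup>2 * exp q"
        using small(2)[OF u] by (intro mult_mono) auto
      then show "exp (e * ln u) - 1 \<le> e * ln u + e\<^sup>2 * (q\<^sup>2 * exp q)"
        using exp_minus_one_minus_le[of "e * ln u"] by (simp add: power_mult_distrib mult.assoc)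
    qed (intro continuous_intros cl)+
    also have "\<dots> = e * trln x + e\<^sup>2 * (q\<^sup>2 * exp q)"
      using cl by (simp add: rcf_add[OF sx] rcf_scaleR[OF sx] rcf_const[OF sx] continuous_intros
          tr_add tr_scaleR tr_one trln_def)
    finally have d_tr: "tr d \<le> e * trln x + e\<^sup>2 * (q\<^sup>2 * exp q)" .
    \<comment> \<open>\<open>Z\<close> moves from \<open>y\<close> to \<open>x * y * x\<close> in
      \<open>n\<close> equal congruence steps, and \<open>W\<close> follows with the
      inverses.\<close>
    define Z where "Z k = V (real k * e) * y * V (real k * e)" for k :: nat
    define W where "W k = V (- (real k * e)) * yi * V (- (real k * e))" for k :: nat
    have Z: "Z k \<in> pos_invertibles" for k
      unfolding Z_def using V_inv by (intro pos_invertibles_congruence sV y) (auto simp: invertible_elem_iff)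
    have ZW: "is_inverse (Z k) (W k)" for k
      using is_inverse_mult[OF is_inverse_mult[OF V_inv yi] V_inv, of "real k * e" "real k * e"]
      by (simp add: Z_def W_def mult.assoc)
    have ZSuc: "Z (Suc k) = V e * Z k * V e" for k
    proof -
      have 1: "V (real (Suc k) * e) = V e * V (real k * e)" by (simp add: V_add algebra_simps)
      have 2: "V (real (Suc k) * e) = V (real k * e) * V e" by (simp add: V_add algebra_simps)
      show ?thesis unfolding Z_def by (subst 1, subst 2) (simp only: mult.assoc)
    qed
    have sandwich_norm: "norm (a * b * c) \<le> A * norm b * A" if "norm a \<le> A" "norm c \<le> A" for a b c :: 'a and A
    proof -
      have "norm (a * b * c) \<le> norm (a * b) * norm c" by (rule norm_mult_ineq)
      also have "\<dots> \<le> norm a * norm b * norm c" by (intro mult_right_mono norm_mult_ineq) auto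
      also have "\<dots> \<le> A * norm b * A"
        using that order_trans[OF norm_ge_zero that(1)] by (intro mult_mono) auto
      finally show ?thesis .
    qed
    have step: "trln (Z (Suc k)) \<le> trln (Z k) + (2 * (e * trln x) + e\<^sup>2 * K)" if "k < n" for k
    proof -
      have "real k * e \<le> real n * e" using that e by (intro mult_right_mono) auto
      then have k: "\<bar>real k * e\<bar> \<le> 1" "\<bar>- (real k * e)\<bar> \<le> 1" using e by auto
      have nZ: "norm (Z k) \<le> exp q * norm y * exp q"
        unfolding Z_def by (intro sandwich_norm V_norm k)
      have nW: "norm (W k) \<le> exp q * norm yi * exp q"
        unfolding W_def by (intro sandwich_norm V_norm k)
      \<comment> \<open>With \<open>V e = 1 + d\<close>, the two terms of first order both have
        trace \<open>tr d\<close>, one since \<open>W k * Z k = 1\<close> and the other by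
        cyclicity; the last term is of order \<open>e^2\<close>.\<close>
      have "W k * Z (Suc k) = W k * Z k + W k * Z k * d + W k * d * Z k + W k * d * Z k * d"
        unfolding ZSuc by (simp add: d_def algebra_simps)
      also have "W k * Z k = 1" using ZW[of k] by (simp add: is_inverse_def)
      finally have "tr (W k * Z (Suc k)) = 1 + tr d + tr (W k * d * Z k) + tr (W k * d * Z k * d)"
        by (simp add: tr_add tr_one)
      also have "tr (W k * d * Z k) = tr d"
        using ZW[of k] by (subst tr_mult_commute) (simp add: is_inverse_def flip: mult.assoc)
      also have "tr (W k * d * Z k * d) \<le> norm (W k * d * Z k * d)"
        using abs_tr_le_norm abs_le_iff by blast
      also have "norm (W k * d * Z k * d) \<le> norm (W k) * norm d * norm (Z k) * norm d"
        by (intro order_trans[OF norm_mult_ineq] mult_right_mono norm_ge_zero order_refl)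
      also have "\<dots> = norm (W k) * norm (Z k) * (norm d)\<^sup>2" by (simp add: power2_eq_square)
      also have "\<dots> \<le> C * (e * q * exp q)\<^sup>2"
        unfolding C_def using nZ nW d_norm by (intro mult_mono power_mono) auto
      finally have "tr (W k * Z (Suc k)) \<le> 1 + 2 * tr d + C * (e * q * exp q)\<^sup>2" by simp
      then have "trln (Z (Suc k)) \<le> trln (Z k) + (2 * tr d + C * (e * q * exp q)\<^sup>2)"
        using klein_ln[OF Z[of "Suc k"] Z[of k] ZW[of k]] by simp
      also have "\<dots> \<le> trln (Z k) + (2 * (e * trln x + e\<^sup>2 * (q\<^sup>2 * exp q)) + C * (e * q * exp q)\<^sup>2)"
        using d_tr by simp
      also have "\<dots> = trln (Z k) + (2 * (e * trln x) + e\<^sup>2 * K)"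
        by (simp add: K_def power_mult_distrib algebra_simps)
      finally show ?thesis .
    qed
    have "trln (Z k) \<le> trln y + real k * (2 * (e * trln x) + e\<^sup>2 * K)" if "k \<le> n" for k
      using that
    proof (induction k)
      case 0
      then show ?case by (simp add: Z_def V0)
    next
      case (Suc k)
      then show ?case using step[of k] by (simp add: algebra_simps)
    qed
    \<comment> \<open>After \<open>n\<close> steps with error \<open>e^2 K\<close> each,
      \<open>K / n\<close> is left.\<close>
    from this[of n] have "trln (Z n) \<le> trln y + (2 * ((real n * e) * trln x) + (real n * e) * (e * K))"
      by (simp add: algebra_simps power2_eq_square)
    then show ?thesis by (simp only: e Z_def V1 mult_1) (simp add: e_def)
  qed
  have "(\<lambda>n. trln y + 2 * trln x + K / real n) \<longlonglongrightarrow> trln y + 2 * trln x + 0"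
    by (intro tendsto_intros lim_const_over_n)
  then have "trln (x * y * x) \<le> trln y + 2 * trln x + 0"
    by (rule LIMSEQ_le_const) (intro exI[of _ 1] allI impI main, simp)
  then show ?thesis by simp
qed

lemma trln_inverse:
  assumes x: "x \<in> pos_invertibles"
  shows "trln (rcf inverse x) = - trln x"
proof -
  note sx = pos_invertiblesD(1)[OF x] and px = pos_invertiblesD(2)[OF x]
  have ci: "continuous_on (rspec x) inverse" by (intro continuous_intros) (auto dest: px)
  have "trln (rcf inverse x) = tr (rcf (\<lambda>u. ln (inverse u)) x)"
    by (rule trln_rcf[OF sx ci]) (simp add: px)
  also have "rcf (\<lambda>u. ln (inverse u)) x = rcf (\<lambda>u. - ln u) x"
    by (rule rcf_cong[OF sx]) (auto simp: ln_inverse px intro!: continuous_intros dest!: px)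
  finally show ?thesis
    by (simp add: rcf_minus[OF sx] continuous_on_ln_rspec[OF x] tr_minus trln_def)
qed

text \<open>The inequality applied to the inverse of \<open>x\<close> and to
  \<open>x * y * x\<close> gives the other direction, as \<open>trln_inverse\<close> changes the
  sign of the correction.\<close>

theorem trln_congruence:
  assumes x: "x \<in> pos_invertibles" and y: "y \<in> pos_invertibles"
  shows "trln (x * y * x) = trln y + 2 * trln x"
proof (rule antisym)
  note sx = pos_invertiblesD(1)[OF x] and px = pos_invertiblesD(2)[OF x]
  have ci: "continuous_on (rspec x) inverse" by (intro continuous_intros) (auto dest: px)
  let ?z = "rcf inverse x"
  have z: "?z \<in> pos_invertibles" by (rule rcf_pos_invertibles[OF sx ci]) (simp add: px)
  have inv: "?z * x = 1" "x * ?z = 1" using is_inverse_rcf_inverse[OF x] by (auto simp: is_inverse_def)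
  have "x * y * x \<in> pos_invertibles"
    using x y by (intro pos_invertibles_congruence sx) (auto simp: pos_invertibles_def)
  then have "trln (?z * (x * y * x) * ?z) \<le> trln (x * y * x) + 2 * trln ?z"
    by (rule trln_congruence_le[OF z])
  also have "?z * (x * y * x) * ?z = (?z * x) * y * (x * ?z)" by (simp only: mult.assoc)
  finally show "trln y + 2 * trln x \<le> trln (x * y * x)" by (simp add: inv trln_inverse[OF x])
qed (rule trln_congruence_le[OF x y])

end

section \<open>The metric\<close>

definition lncosh :: "real \<Rightarrow> real" where
  "lncosh s = ln (cosh s)"

lemma lncosh_abs: "lncosh \<bar>s\<bar> = lncosh s"
  by (simp add: lncosh_def)

lemma lncosh_nonneg: "0 \<le> lncosh s"
  by (simp add: lncosh_def cosh_real_ge_1)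

lemma lncosh_mono: "\<bar>s\<bar> \<le> t \<Longrightarrow> lncosh s \<le> lncosh t"
  using cosh_real_nonneg_le_iff[of "\<bar>s\<bar>" t] cosh_real_abs[of s]
  by (auto simp: lncosh_def cosh_real_pos)

lemma DERIV_lncosh: "(lncosh has_real_derivative tanh s) (at s)"
  unfolding lncosh_def by (auto intro!: derivative_eq_intros simp: tanh_def cosh_real_pos)

lemma le_sinh_mult_cosh:
  assumes "0 \<le> t"
  shows "t \<le> sinh t * cosh (t::real)"
proof -
  have "sinh 0 * cosh 0 - 0 \<le> sinh t * cosh t - t"
  proof (rule DERIV_nonneg_imp_nondecreasing[OF assms])
    fix s :: real
    have "((\<lambda>s. sinh s * cosh s - s) has_real_derivative 2 * (sinh s)\<^sup>2) (at s)"
      by (auto intro!: derivative_eq_intros simp: cosh_square_eq power2_eq_square algebra_simps)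
        (simp flip: power2_eq_square add: cosh_square_eq)
    then show "\<exists>y. ((\<lambda>s. sinh s * cosh s - s) has_real_derivative y) (at s) \<and> 0 \<le> y" by auto
  qed
  then show ?thesis by simp
qed

text \<open>For \<open>t > 0\<close> this is the sign of the derivative of
  \<open>lncosh t / t^2\<close>. The difference of the two sides increases because
  \<open>tanh s - s (1 - tanh^2 s)\<close> is nonnegative, which is \<open>le_sinh_mult_cosh\<close>
  divided by \<open>cosh^2 s\<close>.\<close>

lemma mult_tanh_le_lncosh:
  assumes "0 \<le> t"
  shows "t * tanh t \<le> 2 * lncosh t"
proof -
  have "2 * lncosh 0 - 0 * tanh 0 \<le> 2 * lncosh t - t * tanh t"
  proof (rule DERIV_nonneg_imp_nondecreasing[OF assms])
    fix s :: real assume s: "0 \<le> s"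
    have "((\<lambda>s. 2 * lncosh s - s * tanh s) has_real_derivative (2 * tanh s - (tanh s + s * (1 - (tanh s)\<^sup>2)))) (at s)"
      by (auto intro!: derivative_eq_intros DERIV_lncosh)
    moreover have "s * (1 - (tanh s)\<^sup>2) \<le> tanh s"
    proof -
      have c: "cosh s > 0" by (rule cosh_real_pos)
      have "1 - (tanh s)\<^sup>2 = ((cosh s)\<^sup>2 - (sinh s)\<^sup>2) / (cosh s)\<^sup>2"
        using c by (simp add: tanh_def power_divide diff_divide_distrib)
      then have "1 - (tanh s)\<^sup>2 = 1 / (cosh s)\<^sup>2" by (simp add: cosh_square_eq)
      moreover have "s \<le> tanh s * (cosh s)\<^sup>2"
        using le_sinh_mult_cosh[OF s] c by (simp add: tanh_def power2_eq_square)
      ultimately show ?thesis using c by (simp add: pos_divide_le_eq)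
    qed
    ultimately show "\<exists>y. ((\<lambda>s. 2 * lncosh s - s * tanh s) has_real_derivative y) (at s) \<and> 0 \<le> y"
      by (intro exI conjI) auto
  qed
  then show ?thesis by (simp add: lncosh_def)
qed

lemma lncosh_ratio_antimono:
  assumes "0 < x" "x \<le> y"
  shows "lncosh y / y\<^sup>2 \<le> lncosh x / x\<^sup>2"
proof (rule DERIV_nonpos_imp_nonincreasing[OF assms(2)])
  fix t assume "x \<le> t"
  then have t: "t > 0" using assms(1) by simp
  have "((\<lambda>t. lncosh t / t\<^sup>2) has_real_derivative (tanh t * t\<^sup>2 - lncosh t * (2 * t)) / (t\<^sup>2 * t\<^sup>2)) (at t)"
    using t by (auto intro!: derivative_eq_intros DERIV_lncosh)
  moreover have "tanh t * t\<^sup>2 - lncosh t * (2 * t) \<le> 0"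
    using mult_left_mono[OF mult_tanh_le_lncosh[of t], of t] t
    by (simp add: power2_eq_square algebra_simps)
  ultimately show "\<exists>y. ((\<lambda>t. lncosh t / t\<^sup>2) has_real_derivative y) (at t) \<and> y \<le> 0"
    by (intro exI conjI) (auto simp: divide_nonpos_nonneg)
qed

text \<open>By \<open>lncosh_ratio_antimono\<close> the parabola \<open>R r^2\<close> that meets
  \<open>lncosh\<close> at \<open>S\<close>, the sum of the absolute values, stays below it at
  \<open>p\<close> and \<open>q\<close>. So the elementary bound for \<open>S^2\<close>, which is a
  completed square, carries over from squares to \<open>lncosh\<close>.\<close>

lemma lncosh_add_le:
  assumes l: "0 < l" "l < 1"
  shows "lncosh (p + q) \<le> lncosh p / l + lncosh q / (1 - l)"
proof -
  have weak: "lncosh r \<le> lncosh r / k" if "0 < k" "k < 1" for r k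
    using that lncosh_nonneg[of r] by (simp add: pos_le_divide_eq mult_right_le_one_le)
  have nn: "0 \<le> lncosh r / k" if "0 < k" for r k
    using that lncosh_nonneg[of r] by simp
  show ?thesis
  proof (cases "p = 0 \<or> q = 0")
    case True
    then show ?thesis using l weak[of l p] weak[of "1 - l" q] nn[of l p] nn[of "1 - l" q] by auto
  next
    case False
    define S where "S = \<bar>p\<bar> + \<bar>q\<bar>"
    have S: "S > 0" "\<bar>p\<bar> \<le> S" "\<bar>q\<bar> \<le> S" using False by (auto simp: S_def)
    define R where "R = lncosh S / S\<^sup>2"
    have R: "R \<ge> 0" using lncosh_nonneg by (simp add: R_def)
    have low: "R * r\<^sup>2 \<le> lncosh r" if "r \<noteq> 0" "\<bar>r\<bar> \<le> S" for r
      using lncosh_ratio_antimono[of "\<bar>r\<bar>" S] that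
      by (simp add: R_def lncosh_abs field_simps)
    have "(\<bar>p\<bar> + \<bar>q\<bar>)\<^sup>2 \<le> p\<^sup>2 / l + q\<^sup>2 / (1 - l)"
    proof -
      have "0 \<le> ((1 - l) * \<bar>p\<bar> - l * \<bar>q\<bar>)\<^sup>2 / (l * (1 - l))" using l by simp
      also have "\<dots> = p\<^sup>2 / l + q\<^sup>2 / (1 - l) - (\<bar>p\<bar> + \<bar>q\<bar>)\<^sup>2"
        using l by (simp add: divide_simps) (simp add: power2_eq_square algebra_simps)
      finally show ?thesis by simp
    qed
    then have "R * S\<^sup>2 \<le> R * (p\<^sup>2 / l + q\<^sup>2 / (1 - l))"
      unfolding S_def[symmetric] by (intro mult_left_mono R)
    also have "\<dots> = R * p\<^sup>2 / l + R * q\<^sup>2 / (1 - l)" by (simp add: distrib_left)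
    also have "\<dots> \<le> lncosh p / l + lncosh q / (1 - l)"
      using False S l by (intro add_mono divide_right_mono low) auto
    finally have "lncosh S \<le> lncosh p / l + lncosh q / (1 - l)" using S by (simp add: R_def)
    then show ?thesis using lncosh_mono[OF abs_triangle_ineq[of p q]] by (simp add: S_def)
  qed
qed

definition ldiv :: "real \<Rightarrow> real \<Rightarrow> real" where
  "ldiv u v = ln ((u + v) / 2) - ln u / 2 - ln v / 2"

text \<open>The arithmetic mean of \<open>u\<close> and \<open>v\<close> is their geometric mean
  times the hyperbolic cosine of half the difference of their logarithms.\<close>

lemma ldiv_eq_lncosh:
  assumes "u > 0" "v > 0"
  shows "ldiv u v = lncosh ((ln u - ln v) / 2)"
proof -
  define s t where "s = ln u / 2" and "t = ln v / 2"
  have u: "u = exp (2 * s)" "v = exp (2 * t)" using assms by (simp_all add: s_def t_def)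
  have "(u + v) / 2 = exp (s + t) * cosh (s - t)"
    by (simp add: u cosh_field_def distrib_left flip: exp_add)
  then have "ln ((u + v) / 2) = s + t + lncosh (s - t)"
    by (simp add: ln_mult lncosh_def cosh_real_pos)
  then show ?thesis by (simp add: ldiv_def s_def t_def diff_divide_distrib)
qed

lemma ldiv_nonneg: "u > 0 \<Longrightarrow> v > 0 \<Longrightarrow> 0 \<le> ldiv u v"
  by (simp add: ldiv_eq_lncosh lncosh_nonneg)

lemma ldiv_one_eq_0_imp:
  assumes "v > 0" "ldiv 1 v = 0"
  shows "v = 1"
proof -
  have "ln (cosh (- ln v / 2)) = 0" using assms by (simp add: ldiv_eq_lncosh lncosh_def)
  then have "cosh (- ln v / 2) = 1" using ln_eq_zero_iff[OF cosh_real_pos] by blast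
  then have "ln v = 0" by simp
  then show ?thesis using assms(1) by simp
qed

lemma ldiv_triangle_weighted:
  assumes "u > 0" "v > 0" "0 < l" "l < 1"
  shows "ldiv 1 v \<le> ldiv 1 u / l + ldiv u v / (1 - l)"
proof -
  have "lncosh (- ln v / 2) \<le> lncosh (- ln u / 2) / l + lncosh ((ln u - ln v) / 2) / (1 - l)"
    using lncosh_add_le[OF assms(3,4), of "- ln u / 2" "(ln u - ln v) / 2"]
    by (simp only: add_divide_distrib[symmetric]) simp
  then show ?thesis using assms(1,2) by (simp add: ldiv_eq_lncosh)
qed

section \<open>Passage from scalars to the algebra\<close>

context faithful_tracial_state
begin

text \<open>The tangent of \<open>ln\<close> at \<open>n\<close> is affine, so the joint hypothesis
  on \<open>u\<close> and \<open>v\<close> splits into an affine bound for \<open>f\<close> and one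
  for \<open>g\<close>. These hold in the separate calculi of \<open>a\<close> and \<open>b\<close>
  and add up to an affine bound in the mean \<open>m\<close>.\<close>

lemma tr_rcf_add_le_trln_mean:
  assumes a: "a \<in> pos_invertibles" and b: "b \<in> pos_invertibles"
    and f: "continuous_on (rspec a) f" and g: "continuous_on (rspec b) g"
    and le: "\<And>u v. u \<in> rspec a \<Longrightarrow> v \<in> rspec b \<Longrightarrow> f u + g v \<le> ln ((u + v) / 2)"
  shows "tr (rcf f a) + tr (rcf g b) \<le> trln ((1/2) *\<^sub>R (a + b))"
proof -
  note sa = pos_invertiblesD(1)[OF a] and sb = pos_invertiblesD(1)[OF b]
    and pa = pos_invertiblesD(2)[OF a] and pb = pos_invertiblesD(2)[OF b]
  define m where "m = (1/2) *\<^sub>R (a + b)"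
  have m: "m \<in> pos_invertibles"
    unfolding m_def by (intro pos_invertibles_scaleR pos_invertibles_add a b) simp
  note sm = pos_invertiblesD(1)[OF m]
  have "tr (rcf f a + rcf g b) \<le> tr (rcf inverse m * m) + trln m - 1"
  proof (rule tr_le_of_tangent_bounds[OF m])
    fix n :: real and w :: "real \<Rightarrow> real"
    assume n: "n > 0" and w: "continuous_on (rspec m) w" "\<And>x. x \<in> rspec m \<Longrightarrow> 0 \<le> w x"
    let ?c = "inverse n / 2"
    have "continuous_on (rspec a) (\<lambda>u. f u - ?c * u)" by (intro continuous_intros f)
    then obtain u0 where u0: "u0 \<in> rspec a" "\<And>u. u \<in> rspec a \<Longrightarrow> f u - ?c * u \<le> f u0 - ?c * u0"
      using continuous_attains_sup[OF compact_rspec rspec_nonempty[OF sa]] by blast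
    \<comment> \<open>The least intercept with which a line of slope \<open>?c\<close> dominates
      \<open>f\<close>. The rest of the tangent goes to \<open>g\<close>, and \<open>le\<close> at
      the maximiser \<open>u0\<close> shows that it suffices.\<close>
    define e where "e = f u0 - ?c * u0"
    have fe: "f u \<le> ?c * u + e" if "u \<in> rspec a" for u using u0(2)[OF that] by (simp add: e_def)
    have ge: "g v \<le> ?c * v + (ln n - 1 - e)" if "v \<in> rspec b" for v
    proof -
      have "ln ((u0 + v) / 2) \<le> inverse n * ((u0 + v) / 2) + (ln n - 1)"
        using n pa[OF u0(1)] pb[OF that] by (intro ln_le_tangent) auto
      then have "f u0 + g v \<le> inverse n * ((u0 + v) / 2) + (ln n - 1)"
        using le[OF u0(1) that] by linarith
      then show ?thesis by (simp add: e_def algebra_simps add_divide_distrib)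
    qed
    have "tr (rcf w m * rcf f a) \<le> tr (rcf w m * rcf (\<lambda>u. ?c * u + e) a)"
      using fe by (intro tr_mult_rcf_mono sm sa w f continuous_intros) auto
    moreover have "tr (rcf w m * rcf g b) \<le> tr (rcf w m * rcf (\<lambda>v. ?c * v + (ln n - 1 - e)) b)"
      using ge by (intro tr_mult_rcf_mono sm sb w g continuous_intros) auto
    ultimately have "tr (rcf w m * (rcf f a + rcf g b))
      \<le> tr (rcf w m * ((?c *\<^sub>R a + e *\<^sub>R 1) + (?c *\<^sub>R b + (ln n - 1 - e) *\<^sub>R 1)))"
      by (simp only: rcf_affine[OF sa] rcf_affine[OF sb] distrib_left[of "rcf w m"] tr_add)
    also have "(?c *\<^sub>R a + e *\<^sub>R 1) + (?c *\<^sub>R b + (ln n - 1 - e) *\<^sub>R 1)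
        = inverse n *\<^sub>R m + (ln n - 1) *\<^sub>R 1"
      by (simp add: m_def scaleR_add_right scaleR_diff_left)
    finally show "tr (rcf w m * (rcf f a + rcf g b)) \<le> tr (rcf w m * (inverse n *\<^sub>R m + (ln n - 1) *\<^sub>R 1))" .
  qed
  then show ?thesis
    using is_inverse_rcf_inverse[OF m] by (simp add: is_inverse_def tr_add tr_one m_def)
qed

section \<open>The squared distance and the triangle inequality\<close>

definition lndist_sq :: "'a \<Rightarrow> 'a \<Rightarrow> real" where
  "lndist_sq a b = trln ((1/2) *\<^sub>R (a + b)) - trln a / 2 - trln b / 2"

lemma lndist_sq_commute: "lndist_sq a b = lndist_sq b a"
  by (simp add: lndist_sq_def add.commute)

lemma lndist_sq_self: "lndist_sq a a = 0"
  by (simp add: lndist_sq_def scaleR_2[symmetric])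

lemma continuous_on_ldiv_one: "b \<in> pos_invertibles \<Longrightarrow> continuous_on (rspec b) (ldiv 1)"
  unfolding ldiv_def by (intro continuous_intros) (auto dest: pos_invertiblesD(2))

lemma trln_one: "trln 1 = 0"
  using trln_rcf[of 1 "\<lambda>_. 1"] by (simp add: rcf_one rcf_const tr_zero)

text \<open>Since \<open>1\<close> commutes with \<open>b\<close>, the whole divergence lives in the
  calculus of \<open>b\<close> and is the trace of its scalar counterpart.\<close>

lemma lndist_sq_one:
  assumes b: "b \<in> pos_invertibles"
  shows "lndist_sq 1 b = tr (rcf (ldiv 1) b)"
proof -
  note sb = pos_invertiblesD(1)[OF b] and pb = pos_invertiblesD(2)[OF b]
  have c: "continuous_on (rspec b) (\<lambda>u. ln ((1 + u) / 2))"
    by (intro continuous_intros) (auto dest: pb)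
  note cl = continuous_on_ln_rspec[OF b]
  have "(1/2) *\<^sub>R (1 + b) = rcf (\<lambda>u. (1 + u) / 2) b"
    using rcf_affine[OF sb, of "1/2" "1/2"] by (simp add: scaleR_add_right add_divide_distrib add.commute)
  then have "trln ((1/2) *\<^sub>R (1 + b)) = tr (rcf (\<lambda>u. ln ((1 + u) / 2)) b)"
    using trln_rcf[OF sb, of "\<lambda>u. (1 + u) / 2"] pb by (force intro!: continuous_intros simp: add_pos_pos)
  moreover have "ldiv 1 = (\<lambda>u. 1 * ln ((1 + u) / 2) + (- 1/2) * ln u)"
    by (simp add: fun_eq_iff ldiv_def)
  then have "tr (rcf (ldiv 1) b) = 1 * tr (rcf (\<lambda>u. ln ((1 + u) / 2)) b) + (- 1/2) * tr (rcf ln b)"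
    by (simp only: tr_rcf_lincomb[OF sb c cl])
  ultimately show ?thesis
    by (simp add: lndist_sq_def trln_one flip: trln_def)
qed

lemma lndist_sq_one_nonneg: "b \<in> pos_invertibles \<Longrightarrow> 0 \<le> lndist_sq 1 b"
  unfolding lndist_sq_one
  by (intro tr_rcf_nonneg continuous_on_ldiv_one ldiv_nonneg) (auto dest: pos_invertiblesD)

text \<open>Faithfulness applies to the square root of \<open>ldiv 1\<close> at \<open>b\<close>;
  its vanishing forces every spectral value to be \<open>1\<close>.\<close>

lemma lndist_sq_one_eq_0_imp:
  assumes b: "b \<in> pos_invertibles" and z: "lndist_sq 1 b = 0"
  shows "b = 1"
proof -
  note sb = pos_invertiblesD(1)[OF b] and pb = pos_invertiblesD(2)[OF b]
  let ?s = "\<lambda>u. sqrt (ldiv 1 u)"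
  note cd = continuous_on_ldiv_one[OF b]
  have cs: "continuous_on (rspec b) ?s" by (intro continuous_intros cd)
  have "rcf (ldiv 1) b = star (rcf ?s b) * rcf ?s b"
    unfolding star_rcf[OF sb cs] rcf_mult[OF sb cs cs, symmetric]
    by (rule rcf_cong[OF sb cd]) (simp add: ldiv_nonneg pb)
  then have "rcf ?s b = 0" using z lndist_sq_one[OF b] by (intro tr_star_mult_self_eq_0) simp
  then have "u = 1" if "u \<in> rspec b" for u
    using rcf_norm_lower[OF sb cs that] ldiv_one_eq_0_imp[of u] pb[OF that] by simp
  then have "rcf (\<lambda>u. u) b = rcf (\<lambda>u. 1) b" by (intro rcf_cong sb continuous_intros)
  then show ?thesis by (simp add: rcf_ident[OF sb] rcf_one[OF sb])
qed

text \<open>Each of the three terms gains \<open>2 * trln x\<close>, and their coefficients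
  \<open>1\<close>, \<open>- 1/2\<close>, \<open>- 1/2\<close> add up to zero.\<close>

lemma lndist_sq_congruence:
  assumes x: "x \<in> pos_invertibles" and a: "a \<in> pos_invertibles" and b: "b \<in> pos_invertibles"
  shows "lndist_sq (x * a * x) (x * b * x) = lndist_sq a b"
proof -
  have eq: "(1/2) *\<^sub>R (x * a * x + x * b * x) = x * ((1/2) *\<^sub>R (a + b)) * x"
    by (simp add: algebra_simps)
  have "(1/2) *\<^sub>R (a + b) \<in> pos_invertibles"
    by (intro pos_invertibles_scaleR pos_invertibles_add a b) simp
  from trln_congruence[OF x this] show ?thesis
    unfolding lndist_sq_def eq trln_congruence[OF x a] trln_congruence[OF x b]
    by (simp add: add_divide_distrib)
qed

text \<open>The witness is \<open>a\<close> to the power \<open>- 1/2\<close>.\<close>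

lemma normalizer:
  assumes a: "a \<in> pos_invertibles"
  obtains x where "x \<in> pos_invertibles" "x * a * x = 1"
proof -
  note sa = pos_invertiblesD(1)[OF a] and pa = pos_invertiblesD(2)[OF a]
  let ?f = "\<lambda>u. inverse (sqrt u)"
  have f: "continuous_on (rspec a) ?f" by (intro continuous_intros) (auto dest: pa)
  have "rcf ?f a * a * rcf ?f a = rcf (\<lambda>u. ?f u * u * ?f u) a"
    using f by (simp add: rcf_mult[OF sa] continuous_on_mult continuous_on_id rcf_ident[OF sa])
  also have "\<dots> = rcf (\<lambda>u. 1) a"
  proof (rule rcf_cong[OF sa])
    fix u assume "u \<in> rspec a"
    then have "u > 0" by (rule pa)
    then have "sqrt u * sqrt u = u" "sqrt u \<noteq> 0" by auto
    then show "?f u * u * ?f u = 1" by (simp add: field_simps)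
  qed (intro continuous_intros f)
  finally have "rcf ?f a * a * rcf ?f a = 1" by (simp add: rcf_one[OF sa])
  moreover have "rcf ?f a \<in> pos_invertibles" by (rule rcf_pos_invertibles[OF sa f]) (simp add: pa)
  ultimately show thesis using that by blast
qed

lemma congruence_pos_invertibles:
  fixes x a :: 'a
  shows "x \<in> pos_invertibles \<Longrightarrow> a \<in> pos_invertibles \<Longrightarrow> x * a * x \<in> pos_invertibles"
  by (intro pos_invertibles_congruence) (auto simp: pos_invertibles_def positive_elem_def)

lemma lndist_sq_nonneg:
  assumes a: "a \<in> pos_invertibles" and b: "b \<in> pos_invertibles"
  shows "0 \<le> lndist_sq a b"
proof -
  obtain x where x: "x \<in> pos_invertibles" "x * a * x = 1" using normalizer[OF a] .
  have "lndist_sq a b = lndist_sq 1 (x * b * x)"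
    using lndist_sq_congruence[OF x(1) a b] x(2) by simp
  then show ?thesis using lndist_sq_one_nonneg congruence_pos_invertibles[OF x(1) b] by simp
qed

lemma lndist_sq_eq_0_imp:
  assumes a: "a \<in> pos_invertibles" and b: "b \<in> pos_invertibles" and z: "lndist_sq a b = 0"
  shows "a = b"
proof -
  obtain x where x: "x \<in> pos_invertibles" "x * a * x = 1" using normalizer[OF a] .
  have "lndist_sq 1 (x * b * x) = 0"
    using lndist_sq_congruence[OF x(1) a b] x(2) z by simp
  then have e: "x * b * x = x * a * x"
    using lndist_sq_one_eq_0_imp congruence_pos_invertibles[OF x(1) b] x(2) by simp
  obtain y where y: "x * y = 1" "y * x = 1"
    using x(1) by (auto simp: pos_invertibles_def invertible_elem_def)
  have cancel: "y * (x * w * x) * y = w" for w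
  proof -
    have "y * (x * w * x) * y = (y * x) * w * (x * y)" by (simp only: mult.assoc)
    then show ?thesis by (simp add: y)
  qed
  have "a = y * (x * a * x) * y" by (rule cancel[symmetric])
  also have "\<dots> = y * (x * b * x) * y" by (simp only: e)
  also have "\<dots> = b" by (rule cancel)
  finally show ?thesis .
qed

lemma lndist_sq_triangle_weighted:
  assumes b: "b \<in> pos_invertibles" and c: "c \<in> pos_invertibles" and l: "0 < l" "l < 1"
  shows "lndist_sq 1 b \<le> lndist_sq 1 c / l + lndist_sq c b / (1 - l)"
proof -
  note sb = pos_invertiblesD(1)[OF b] and pb = pos_invertiblesD(2)[OF b]
    and sc = pos_invertiblesD(1)[OF c] and pc = pos_invertiblesD(2)[OF c]
  note cb = continuous_on_ln_rspec[OF b] continuous_on_ldiv_one[OF b]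
    and cc = continuous_on_ln_rspec[OF c] continuous_on_ldiv_one[OF c]
  \<comment> \<open>The scalar inequality is multiplied by \<open>1 - l\<close> and solved for
    \<open>ln ((u + v) / 2)\<close>; the terms in \<open>u\<close> make up \<open>?f\<close> and
    those in \<open>v\<close> make up \<open>?g\<close>.\<close>
  let ?k = "(1 - l) / l"
  let ?f = "\<lambda>u. (1/2) * ln u + (- ?k) * ldiv 1 u" and ?g = "\<lambda>v. (1/2) * ln v + (1 - l) * ldiv 1 v"
  have "tr (rcf ?f c) + tr (rcf ?g b) \<le> trln ((1/2) *\<^sub>R (c + b))"
  proof (rule tr_rcf_add_le_trln_mean[OF c b])
    fix u v assume "u \<in> rspec c" "v \<in> rspec b"
    then have uv: "u > 0" "v > 0" using pb pc by auto
    have "(1 - l) * ldiv 1 v \<le> (1 - l) * (ldiv 1 u / l + ldiv u v / (1 - l))"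
      using ldiv_triangle_weighted[OF uv l] l by (intro mult_left_mono) auto
    also have "\<dots> = ?k * ldiv 1 u + ldiv u v" using l by (simp add: distrib_left)
    finally show "?f u + ?g v \<le> ln ((u + v) / 2)" by (simp add: ldiv_def[of u v])
  qed (intro continuous_intros cb cc)+
  moreover have "tr (rcf ?f c) = trln c / 2 - ?k * lndist_sq 1 c"
    unfolding tr_rcf_lincomb[OF sc cc] lndist_sq_one[OF c] trln_def by simp
  moreover have "tr (rcf ?g b) = trln b / 2 + (1 - l) * lndist_sq 1 b"
    unfolding tr_rcf_lincomb[OF sb cb] lndist_sq_one[OF b] trln_def by simp
  ultimately have "(1 - l) * lndist_sq 1 b \<le> ?k * lndist_sq 1 c + lndist_sq c b"
    by (simp add: lndist_sq_def[of c b])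
  also have "\<dots> = (1 - l) * (lndist_sq 1 c / l + lndist_sq c b / (1 - l))"
    using l by (simp add: distrib_left)
  finally show ?thesis using l by simp
qed

text \<open>The minimum of \<open>p^2 / l + q^2 / (1 - l)\<close> over the weights is
  \<open>(p + q)^2\<close>, taken at \<open>l = p / (p + q)\<close>. This weight lies strictly
  between \<open>0\<close> and \<open>1\<close> only if neither distance vanishes; otherwise two of
  the points coincide.\<close>

lemma lndist_triangle_one:
  assumes b: "b \<in> pos_invertibles" and c: "c \<in> pos_invertibles"
  shows "sqrt (lndist_sq 1 b) \<le> sqrt (lndist_sq 1 c) + sqrt (lndist_sq c b)"
proof (cases "lndist_sq 1 c = 0 \<or> lndist_sq c b = 0")
  case True
  then have "c = 1 \<or> c = b" using lndist_sq_one_eq_0_imp[OF c] lndist_sq_eq_0_imp[OF c b] by blast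
  then show ?thesis by (auto simp: lndist_sq_self)
next
  case False
  define p q where "p = sqrt (lndist_sq 1 c)" and "q = sqrt (lndist_sq c b)"
  have pq: "p > 0" "q > 0" "lndist_sq 1 c = p\<^sup>2" "lndist_sq c b = q\<^sup>2"
    using False lndist_sq_one_nonneg[OF c] lndist_sq_nonneg[OF c b] by (auto simp: p_def q_def less_le)
  have l: "0 < p / (p + q)" "p / (p + q) < 1" "1 - p / (p + q) = q / (p + q)"
    using pq by (auto simp: field_simps)
  have "lndist_sq 1 b \<le> p\<^sup>2 / (p / (p + q)) + q\<^sup>2 / (q / (p + q))"
    using lndist_sq_triangle_weighted[OF b c l(1,2)] by (simp only: l(3) pq(3,4))
  also have "\<dots> = p * (p + q) + q * (p + q)" using pq by (simp add: power2_eq_square)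
  also have "\<dots> = (p + q)\<^sup>2" by (simp add: power2_eq_square algebra_simps)
  finally have "sqrt (lndist_sq 1 b) \<le> p + q" using pq by (intro real_le_lsqrt) auto
  then show ?thesis by (simp add: p_def q_def)
qed

lemma lndist_triangle:
  assumes a: "a \<in> pos_invertibles" and c: "c \<in> pos_invertibles" and b: "b \<in> pos_invertibles"
  shows "sqrt (lndist_sq a b) \<le> sqrt (lndist_sq a c) + sqrt (lndist_sq c b)"
proof -
  obtain x where x: "x \<in> pos_invertibles" "x * a * x = 1" using normalizer[OF a] .
  show ?thesis
    using lndist_triangle_one[OF congruence_pos_invertibles[OF x(1) b] congruence_pos_invertibles[OF x(1) c]]
      lndist_sq_congruence[OF x(1) a b] lndist_sq_congruence[OF x(1) a c] lndist_sq_congruence[OF x(1) c b]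
    by (simp add: x(2))
qed

text \<open>The traces in \<open>d_tau_sq\<close> are real because the logarithms are self-adjoint,
  so that \<open>Re\<close> in \<open>d_tau\<close> loses nothing.\<close>

lemma d_tau_sq_eq:
  assumes a: "a \<in> pos_invertibles" and b: "b \<in> pos_invertibles"
  shows "d_tau_sq \<tau> a b = of_real (lndist_sq a b)"
proof -
  have log: "\<tau> (log_elem c) = of_real (trln c)" if c: "c \<in> pos_invertibles" for c
    using tau_selfadjoint_real[OF star_rcf[OF pos_invertiblesD(1)[OF c] continuous_on_ln_rspec[OF c]]]
    by (simp add: log_elem_eq_rcf[OF c] trln_def tr_def complex_eq_iff)
  have "(1 / 2) *\<^sub>C (a + b) = (1/2) *\<^sub>R (a + b)" by (simp add: scaleR_scaleC)
  moreover have "(1/2) *\<^sub>R (a + b) \<in> pos_invertibles"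
    by (intro pos_invertibles_scaleR pos_invertibles_add a b) simp
  ultimately show ?thesis by (simp add: d_tau_sq_def lndist_sq_def log a b)
qed

lemma Metric_space_d_tau:
  assumes "M \<subseteq> pos_invertibles"
  shows "Metric_space M (restrict_dist M (d_tau \<tau>))"
proof -
  have d: "d_tau \<tau> a b = sqrt (lndist_sq a b)" if "a \<in> M" "b \<in> M" for a b
    using that assms by (simp add: d_tau_def d_tau_sq_eq subset_iff)
  show ?thesis
  proof
    fix a b
    show "0 \<le> restrict_dist M (d_tau \<tau>) a b"
      using assms by (auto simp: restrict_dist_def d intro!: lndist_sq_nonneg)
    show "restrict_dist M (d_tau \<tau>) a b = restrict_dist M (d_tau \<tau>) b a"
      by (simp add: restrict_dist_def d lndist_sq_commute)
    show "restrict_dist M (d_tau \<tau>) a b = 0 \<longleftrightarrow> a = b" if "a \<in> M" "b \<in> M"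
      using that assms by (auto simp: restrict_dist_def d lndist_sq_self intro: lndist_sq_eq_0_imp)
    show "restrict_dist M (d_tau \<tau>) a c \<le> restrict_dist M (d_tau \<tau>) a b + restrict_dist M (d_tau \<tau>) b c"
      if "a \<in> M" "b \<in> M" "c \<in> M" for c
      using that assms by (auto simp: restrict_dist_def d intro!: lndist_triangle)
  qed
qed

end

theorem theorem1p2:
  fixes \<tau> :: "'a::cstar_algebra \<Rightarrow> complex"
  assumes "faithful_tracial_state \<tau>"
  shows "(\<forall>A\<in>pos_invertibles. \<forall>B\<in>pos_invertibles. d_tau_sq \<tau> A B \<in> \<real>\<^sub>\<ge>\<^sub>0)
    \<and> Metric_space pos_invertibles (restrict_dist pos_invertibles (d_tau \<tau>))
    \<and> Metric_space (pos_densities \<tau>) (restrict_dist (pos_densities \<tau>) (d_tau \<tau>))"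
proof -
  interpret faithful_tracial_state \<tau> by (rule assms)
  have "pos_densities \<tau> \<subseteq> pos_invertibles" by (auto simp: pos_densities_def)
  then show ?thesis
    using Metric_space_d_tau lndist_sq_nonneg by (simp add: d_tau_sq_eq)
qed

end
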